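(* Let $I=[0,1]$ with the Euclidean metric. There are a continuous map $f\colon I\to I$ with zero topological entropy (actually, not Li-Yorke chaotic) and a point $x\in I$ with solenoidal $\omega_f(x)$ such that for every integer $m\ge2$, $$\liminf_{\varepsilon\to0}\operatorname{rdet}_m(x,\varepsilon)<1\qquad\text{and}\qquad\liminf_{\varepsilon\to0}\lim_{n\to\infty}\operatorname{DET}_m(x,n,\varepsilon)<1.$$
   Context: $\mathbb{N}=\{1,2,\dots\}$, and $\varrho(x,y)=|x-y|$. For $m\in\mathbb{N}$, Bowen's metric is $\varrho_m(x,y)=\max\{\varrho(f^i(x),f^i(y)):0\le i<m\}$. For $x\in I$, $n\in\mathbb{N}$, $\varepsilon>0$, $$C_m(x,n,\varepsilon)=\frac1{n^2}\#\{(i,j):0\le i,j<n,\ \varrho_m(f^i(x),f^j(x))\le\varepsilon\},\qquad \operatorname{rdet}_m(x,n,\varepsilon)=\frac{C_m(x,n,\varepsilon)}{C_1(x,n,\varepsilon)},$$ $$\operatorname{DET}_m(x,n,\varepsilon)=m\cdot\operatorname{rdet}_m(x,n,\varepsilon)-(m-1)\cdot\operatorname{rdet}_{m+1}(x,n,\varepsilon).$$ The asymptotic recurrence $m$-determinism is $\operatorname{rdet}_m(x,\varepsilon)=\lim_{n\to\infty}\operatorname{rdet}_m(x,n,\varepsilon)$ when this limit exists. The claim includes that, for the point $x$ in question, the limits as $n\to\infty$ exist for all $\varepsilon>0$. $\omega_f(x)$ is the set of all limit points of the trajectory $(f^n(x))_{n\ge0}$. A compact interval $J\subseteq I$ is $p$-periodic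 ($p\in\mathbb{N}$) if $f^p(J)=J$ and $f^k(J)$, $0\le k<p$, are pairwise disjoint. The set $\omega_f(x)$ is solenoidal if there are integers $2\le p_0<p_1<\dots$ and nondegenerate closed intervals $J_0\supseteq J_1\supseteq\dots$ in $I$ such that every $J_t$ is $p_t$-periodic and $\omega_f(x)\subseteq\bigcap_{t\ge0}\bigsqcup_{i=0}^{p_t-1}f^i(J_t)$. A map $f$ is Li-Yorke chaotic if there is an uncountable set $S\subseteq I$ such that for all distinct $u,v\in S$, $\liminf_{n\to\infty}\varrho(f^n(u),f^n(v))=0$ and $\limsup_{n\to\infty}\varrho(f^n(u),f^n(v))>0$. *)

theory Defs
  imports "HOL-Analysis.Analysis"
begin

text \<open>
  A self-map of the interval \<open>I = [0,1]\<close> is a function \<open>f :: real \<Rightarrow> real\<close> that is continuous on \<open>I\<close>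
  and maps \<open>I\<close> into \<open>I\<close>; its values outside \<open>I\<close> play no role, since all notions below are evaluated
  on subsets of \<open>I\<close>.
\<close>

definition bowen_dist :: "('a::metric_space \<Rightarrow> 'a) \<Rightarrow> nat \<Rightarrow> 'a \<Rightarrow> 'a \<Rightarrow> real" where
  "bowen_dist f m x y = Max ((\<lambda>i. dist ((f ^^ i) x) ((f ^^ i) y)) ` {..<m})"

definition corr_sum :: "('a::metric_space \<Rightarrow> 'a) \<Rightarrow> nat \<Rightarrow> 'a \<Rightarrow> nat \<Rightarrow> real \<Rightarrow> real" where
  "corr_sum f m x n \<epsilon> =
     real (card {(i, j). i < n \<and> j < n \<and> bowen_dist f m ((f ^^ i) x) ((f ^^ j) x) \<le> \<epsilon>}) / (real n)\<^sup>2"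

definition rdet :: "('a::metric_space \<Rightarrow> 'a) \<Rightarrow> nat \<Rightarrow> 'a \<Rightarrow> nat \<Rightarrow> real \<Rightarrow> real" where
  "rdet f m x n \<epsilon> = corr_sum f m x n \<epsilon> / corr_sum f 1 x n \<epsilon>"

definition DET :: "('a::metric_space \<Rightarrow> 'a) \<Rightarrow> nat \<Rightarrow> 'a \<Rightarrow> nat \<Rightarrow> real \<Rightarrow> real" where
  "DET f m x n \<epsilon> = real m * rdet f m x n \<epsilon> - (real m - 1) * rdet f (m + 1) x n \<epsilon>"

text \<open>The following two limits are meaningful only if the corresponding sequences converge.\<close>

definition asymp_rdet :: "('a::metric_space \<Rightarrow> 'a) \<Rightarrow> nat \<Rightarrow> 'a \<Rightarrow> real \<Rightarrow> real" where
  "asymp_rdet f m x \<epsilon> = lim (\<lambda>n. rdet f m x n \<epsilon>)"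

definition asymp_DET :: "('a::metric_space \<Rightarrow> 'a) \<Rightarrow> nat \<Rightarrow> 'a \<Rightarrow> real \<Rightarrow> real" where
  "asymp_DET f m x \<epsilon> = lim (\<lambda>n. DET f m x n \<epsilon>)"

definition omega_limit_set :: "('a::topological_space \<Rightarrow> 'a) \<Rightarrow> 'a \<Rightarrow> 'a set" where
  "omega_limit_set f x =
     {y. \<exists>r :: nat \<Rightarrow> nat. strict_mono r \<and> (\<lambda>n. (f ^^ r n) x) \<longlonglongrightarrow> y}"

text \<open>Disjointness refers to distinct indices, so equal images \<open>f\<^sup>i(J) = f\<^sup>k(J)\<close>, \<open>i \<noteq> k\<close>, are excluded.\<close>

definition periodic_set :: "('a \<Rightarrow> 'a) \<Rightarrow> nat \<Rightarrow> 'a set \<Rightarrow> bool" where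
  "periodic_set f p J \<longleftrightarrow>
     1 \<le> p \<and> (f ^^ p) ` J = J \<and> disjoint_family_on (\<lambda>k. (f ^^ k) ` J) {..<p}"

definition solenoidal :: "real set \<Rightarrow> (real \<Rightarrow> real) \<Rightarrow> real set \<Rightarrow> bool" where
  "solenoidal I f W \<longleftrightarrow>
     (\<exists>(p :: nat \<Rightarrow> nat) (a :: nat \<Rightarrow> real) (b :: nat \<Rightarrow> real).
        2 \<le> p 0 \<and> strict_mono p \<and>
        (\<forall>t. a t < b t \<and> {a t..b t} \<subseteq> I \<and> {a (Suc t)..b (Suc t)} \<subseteq> {a t..b t} \<and>
             periodic_set f (p t) {a t..b t}) \<and>
        W \<subseteq> (\<Inter>t. \<Union>i<p t. (f ^^ i) ` {a t..b t}))"

definition Li_Yorke_chaotic :: "'a::metric_space set \<Rightarrow> ('a \<Rightarrow> 'a) \<Rightarrow> bool" where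
  "Li_Yorke_chaotic X f \<longleftrightarrow>
     (\<exists>S \<subseteq> X. uncountable S \<and>
        (\<forall>u \<in> S. \<forall>v \<in> S. u \<noteq> v \<longrightarrow>
           liminf (\<lambda>n. ereal (dist ((f ^^ n) u) ((f ^^ n) v))) = 0 \<and>
           limsup (\<lambda>n. ereal (dist ((f ^^ n) u) ((f ^^ n) v))) > 0))"

definition separated_set :: "'a::metric_space set \<Rightarrow> ('a \<Rightarrow> 'a) \<Rightarrow> nat \<Rightarrow> real \<Rightarrow> 'a set \<Rightarrow> bool" where
  "separated_set X f n \<epsilon> E \<longleftrightarrow>
     E \<subseteq> X \<and> finite E \<and> (\<forall>u \<in> E. \<forall>v \<in> E. u \<noteq> v \<longrightarrow> bowen_dist f n u v > \<epsilon>)"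

text \<open>
  Topological entropy by Bowen's definition: the inner supremum is the logarithm of the maximal
  cardinality of an \<open>(n,\<epsilon>)\<close>-separated set (the empty set contributes \<open>ln 0 = 0\<close>, the value of a
  singleton). The exponential growth rate is antitone in \<open>\<epsilon>\<close>, so its limit for \<open>\<epsilon> \<rightarrow> 0\<close> is the
  outer supremum.
\<close>

definition topological_entropy :: "'a::metric_space set \<Rightarrow> ('a \<Rightarrow> 'a) \<Rightarrow> ereal" where
  "topological_entropy X f =
     (SUP \<epsilon> \<in> {0<..}. limsup (\<lambda>n.
        (SUP E \<in> {E. separated_set X f n \<epsilon> E}. ereal (ln (real (card E)))) / ereal (real n)))"

end

theory Submission
  imports Defs "HOL-Real_Asymp.Real_Asymp"
begin

text \<open>
  Delahaye's map \<open>g\<close> is infinitely renormalizable: it exchanges \<open>[0,1/3]\<close> and \<open>[2/3,1]\<close>, \<open>g\<^sup>2\<close> restricted to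
  either of them is a scaled copy of \<open>g\<close>, and \<open>g\<close> is affine and expanding in between. The map \<open>f\<close> of the
  theorem is obtained by the same construction with the asymmetric intervals \<open>[0,1/3]\<close> and \<open>[8/9,1]\<close>,
  so that \<open>f\<close> contracts the first onto the second by the factor \<open>1/3\<close>. On the orbit of \<open>x = 0\<close>, points at
  even times form a copy of the ternary van der Corput sequence at scale \<open>1/3\<close> and points at odd times a
  copy at scale \<open>1/9\<close>. With \<open>\<epsilon> = 3\<^sup>-\<^sup>k\<close>, two odd times are \<open>\<epsilon>\<close>-close iff they agree modulo \<open>2\<^sup>k\<^sup>-\<^sup>1\<close>,
  whereas two even times have to agree modulo \<open>2\<^sup>k\<close>. For \<open>m \<ge> 2\<close> Bowen's metric always sees an
  even time, hence the stricter condition holds for all pairs, and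
  \<open>rdet\<^sub>m = 2\<^sup>-\<^sup>k / ((2\<^sup>-\<^sup>k + 2\<^sup>1\<^sup>-\<^sup>k) / 2) = 2/3\<close> independently of \<open>m\<close>, so that also \<open>DET\<^sub>m = 2/3\<close>.

  Entropy zero and the absence of Li-Yorke pairs pass from scale \<open>3\<epsilon>\<close> for \<open>g\<close> to scale \<open>\<epsilon>\<close> for a map
  renormalizing to \<open>g\<close>, and both are trivial at scale \<open>1\<close>.
\<close>

section \<open>Delahaye's map and its asymmetric companion\<close>

definition clamp01 :: "real \<Rightarrow> real" where
  "clamp01 x = max 0 (min 1 x)"

text \<open>The increasing and the decreasing branch of \<open>delahaye\<close>, each lowered by
  2/9, the value of \<open>delahaye (3 * x - 2) / 3\<close> for \<open>x \<le> 2/3\<close>. The two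
  meet at 1/3, and the second reaches 0 at 2/3.\<close>

definition hat :: "real \<Rightarrow> real" where
  "hat x = max 0 (min (x + 4/9) (14/9 - 7/3 * x))"

text \<open>The series is the solution of \<open>g(x) = hat(clamp01(x)) + g(3x - 2)/3\<close>; it is affine on \<open>[0,1/3]\<close> and
  \<open>[1/3,2/3]\<close> because \<open>g = 2/3\<close> on the negative half-line.\<close>

definition delahaye :: "real \<Rightarrow> real" where
  "delahaye x = (\<Sum>k. (1/3)^k * hat (clamp01 (1 - 3^k * (1 - x))))"

lemma hat_clamp_bounds: "0 \<le> hat (clamp01 x)" "hat (clamp01 x) \<le> 7/9"
  unfolding hat_def clamp01_def max_def min_def by (simp_all split: if_splits)

lemma delahaye_term_bound: "norm ((1/3)^k * hat (clamp01 x)) \<le> (1/3)^k * (7/9)"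
  using hat_clamp_bounds[of x] by (simp add: abs_mult)

lemma delahaye_bound_sums: "(\<lambda>k. (1/3)^k * (7/9::real)) sums (7/6)"
  using sums_mult2[OF geometric_sums[of "1/3::real"], of "7/9"] by simp

lemma delahaye_summable: "summable (\<lambda>k. (1/3)^k * hat (clamp01 (1 - 3^k * (1 - x))))"
  by (rule summable_comparison_test'[OF sums_summable[OF delahaye_bound_sums]])
    (rule delahaye_term_bound)

lemma delahaye_continuous: "continuous_on S delahaye"
proof -
  have "uniform_limit UNIV (\<lambda>n x. \<Sum>k<n. (1/3)^k * hat (clamp01 (1 - 3^k * (1 - x))))
      delahaye sequentially"
    unfolding delahaye_def
    by (rule Weierstrass_m_test[OF delahaye_term_bound sums_summable[OF delahaye_bound_sums]])
  then have "continuous_on UNIV delahaye"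
    by (rule uniform_limit_theorem[rotated])
      (auto simp: hat_def clamp01_def intro!: always_eventually continuous_intros)
  then show ?thesis
    using continuous_on_subset by blast
qed

lemma delahaye_rec: "delahaye x = hat (clamp01 x) + delahaye (3 * x - 2) / 3"
proof -
  have "delahaye x = hat (clamp01 x)
      + (\<Sum>k. (1/3)^Suc k * hat (clamp01 (1 - 3^Suc k * (1 - x))))"
    unfolding delahaye_def using suminf_split_head[OF delahaye_summable[of x]] by simp
  also have "(\<lambda>k. (1/3)^Suc k * hat (clamp01 (1 - 3^Suc k * (1 - x))))
      = (\<lambda>k. (1/3) * ((1/3)^k * hat (clamp01 (1 - 3^k * (1 - (3 * x - 2))))))"
    by (rule ext) (simp add: algebra_simps)
  also have "suminf \<dots> = delahaye (3 * x - 2) / 3"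
    unfolding delahaye_def by (subst suminf_mult[OF delahaye_summable]) simp
  finally show ?thesis .
qed

text \<open>For \<open>x \<le> 0\<close> all arguments of \<open>clamp01\<close> in the series are
  nonpositive, so every term is \<open>hat 0 = 4/9\<close> times its weight, and the weights sum to
  3/2.\<close>

lemma delahaye_nonpos:
  assumes "x \<le> 0"
  shows "delahaye x = 2/3"
proof -
  have "hat (clamp01 (1 - 3^k * (1 - x))) = 4/9" for k :: nat
  proof -
    have "1 * 1 \<le> 3^k * (1 - x)"
      using assms by (intro mult_mono) auto
    then show ?thesis
      by (simp add: clamp01_def hat_def)
  qed
  then have "delahaye x = (\<Sum>k. (1/3)^k * (4/9))"
    unfolding delahaye_def by presburger
  also have "\<dots> = 2/3"
    using sums_unique[OF sums_mult2[OF geometric_sums[of "1/3::real"], of "4/9"]] by simp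
  finally show ?thesis .
qed

lemma delahaye_left: "0 \<le> x \<Longrightarrow> x \<le> 1/3 \<Longrightarrow> delahaye x = x + 2/3"
  using delahaye_rec[of x] delahaye_nonpos[of "3 * x - 2"]
  unfolding clamp01_def hat_def max_def min_def by (simp split: if_splits)

lemma delahaye_middle: "1/3 \<le> x \<Longrightarrow> x \<le> 2/3 \<Longrightarrow> delahaye x = 16/9 - 7/3 * x"
  using delahaye_rec[of x] delahaye_nonpos[of "3 * x - 2"]
  unfolding clamp01_def hat_def max_def min_def by (simp split: if_splits)

lemma delahaye_right: "2/3 \<le> x \<Longrightarrow> x \<le> 1 \<Longrightarrow> delahaye x = delahaye (3 * x - 2) / 3"
  using delahaye_rec[of x]
  unfolding clamp01_def hat_def max_def min_def by (simp split: if_splits)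

lemma delahaye_in_unit:
  assumes "x \<in> {0..1}"
  shows "delahaye x \<in> {0..1}"
proof -
  \<comment> \<open>The crude bound 7/6 exceeds 1, but it serves only on the right third, where
    \<open>delahaye_right\<close> divides it by 3.\<close>
  have *: "0 \<le> delahaye y \<and> delahaye y \<le> 7/6" for y
    unfolding delahaye_def
    using suminf_le[OF _ delahaye_summable[of y] sums_summable[OF delahaye_bound_sums]]
      delahaye_term_bound hat_clamp_bounds sums_unique[OF delahaye_bound_sums]
    by (auto intro!: suminf_nonneg[OF delahaye_summable])
  consider "x \<le> 1/3" | "1/3 \<le> x" "x \<le> 2/3" | "2/3 \<le> x" by linarith
  then show ?thesis
  proof cases
    case 1
    then show ?thesis using assms by (simp add: delahaye_left)
  next
    case 2
    then show ?thesis by (simp add: delahaye_middle)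
  next
    case 3
    then show ?thesis using assms *[of "3 * x - 2"] by (simp add: delahaye_right)
  qed
qed

lemma delahaye_surj: "delahaye ` {0..1} = {0..1}"
proof
  show "delahaye ` {0..1} \<subseteq> {0..1}" using delahaye_in_unit by blast
  have "delahaye 1 = 0" using delahaye_right[of 1] by simp
  moreover have "delahaye (1/3) = 1" by (simp add: delahaye_left)
  ultimately show "{0..1} \<subseteq> delahaye ` {0..1}"
    using IVT2'[of delahaye 1 _ "1/3", OF _ _ _ delahaye_continuous] by fastforce
qed

text \<open>The middle branch is the chord from (1/3, 1) to (8/9, 2/9), where 2/9 is
  \<open>delahaye 0 / 3\<close>; its slope -7/5 still expands.\<close>

definition solenoid_map :: "real \<Rightarrow> real" where
  "solenoid_map x =
     (if x \<le> 1/3 then 8/9 + x/3 else if x \<le> 8/9 then 22/15 - 7/5 * x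
      else delahaye (9 * x - 8) / 3)"

lemma solenoid_map_continuous: "continuous_on S solenoid_map"
proof -
  have "continuous_on UNIV (\<lambda>x. delahaye (9 * x - 8))"
    by (rule continuous_on_compose2[OF delahaye_continuous[of UNIV]]) (auto intro!: continuous_intros)
  then have d: "continuous_on {8/9..} (\<lambda>x. delahaye (9 * x - 8) / 3)"
    by (intro continuous_intros) (auto intro: continuous_on_subset)
  have *: "continuous_on ({1/3..8/9} \<union> {8/9..})
      (\<lambda>x::real. if x \<le> 8/9 then 22/15 - 7/5 * x else delahaye (9 * x - 8) / 3)"
    by (intro continuous_on_If d continuous_intros) (auto simp: delahaye_nonpos dest: order_antisym)
  have "continuous_on {1/3..}
      (\<lambda>x::real. if x \<le> 8/9 then 22/15 - 7/5 * x else delahaye (9 * x - 8) / 3)"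
  proof -
    have "{1/3..8/9} \<union> {8/9..} = {1/3::real..}" by auto
    then show ?thesis using * by (simp only:)
  qed
  then have "continuous_on ({..1/3} \<union> {1/3..}) solenoid_map"
    unfolding solenoid_map_def[abs_def]
    by (intro continuous_on_If continuous_intros) auto
  moreover have "{..1/3} \<union> {1/3..} = (UNIV::real set)"
    by auto
  ultimately show ?thesis
    by (metis continuous_on_subset subset_UNIV)
qed

lemma solenoid_map_in_unit: "x \<in> {0..1} \<Longrightarrow> solenoid_map x \<in> {0..1}"
  using delahaye_in_unit[of "9 * x - 8"] by (auto simp: solenoid_map_def)

section \<open>Densities of sets of pairs of natural numbers\<close>

definition pair_density :: "(nat \<Rightarrow> nat \<Rightarrow> bool) \<Rightarrow> nat \<Rightarrow> real" where
  "pair_density P n = real (card {(i, j). i < n \<and> j < n \<and> P i j}) / (real n)\<^sup>2"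

lemma card_residue_pairs:
  assumes "L > 0" "Z \<subseteq> {..<L} \<times> {..<L}"
  shows "card {(i, j). i < q * L \<and> j < q * L \<and> (i mod L, j mod L) \<in> Z} = q\<^sup>2 * card Z"
proof -
  have "bij_betw (\<lambda>((a, b), (r, s)). (a + r * L, b + s * L)) (Z \<times> ({..<q} \<times> {..<q}))
      {(i, j). i < q * L \<and> j < q * L \<and> (i mod L, j mod L) \<in> Z}"
  proof (rule bij_betw_byWitness[where f' = "\<lambda>(i, j). ((i mod L, j mod L), (i div L, j div L))"])
    show "\<forall>z\<in>Z \<times> {..<q} \<times> {..<q}.
        (\<lambda>(i, j). ((i mod L, j mod L), i div L, j div L))
          ((\<lambda>((a, b), r, s). (a + r * L, b + s * L)) z) = z"
      using assms by fastforce
    have *: "a + r * L < q * L" if "a < L" "r < q" for a r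
    proof -
      have "a + r * L < Suc r * L" using that by simp
      also have "\<dots> \<le> q * L" using that by (intro mult_right_mono) auto
      finally show ?thesis .
    qed
    show "(\<lambda>((a, b), r, s). (a + r * L, b + s * L)) ` (Z \<times> {..<q} \<times> {..<q})
        \<subseteq> {(i, j). i < q * L \<and> j < q * L \<and> (i mod L, j mod L) \<in> Z}"
      using assms * by fastforce
  qed (use assms in \<open>auto simp: less_mult_imp_div_less\<close>)
  then show ?thesis
    by (simp add: bij_betw_same_card[symmetric] card_cartesian_product power2_eq_square)
qed

lemma div_ratio_tendsto:
  assumes "L > 0"
  shows "(\<lambda>n. real (n div L) / real n) \<longlonglongrightarrow> 1 / real L"
proof (rule tendsto_sandwich[OF _ _ _ tendsto_const])
  show "(\<lambda>n. 1 / real L - 1 / real n) \<longlonglongrightarrow> 1 / real L"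
    using tendsto_diff[OF tendsto_const lim_1_over_n, of "1 / real L"] by simp
  have *: "real n = real (n div L) * real L + real (n mod L)" for n
    by (metis div_mult_mod_eq of_nat_add of_nat_mult)
  show "\<forall>\<^sub>F n in sequentially. 1 / real L - 1 / real n \<le> real (n div L) / real n"
  proof (rule eventually_mono[OF eventually_gt_at_top[of 0]])
    fix n :: nat assume "n > 0"
    moreover have "real (n mod L) < real L" using assms by simp
    moreover have "real n - real L < real (n div L) * real L"
      using *[of n] \<open>real (n mod L) < real L\<close> by linarith
    ultimately show "1 / real L - 1 / real n \<le> real (n div L) / real n"
      using assms by (simp add: divide_simps mult.commute)
  qed
  show "\<forall>\<^sub>F n in sequentially. real (n div L) / real n \<le> 1 / real L"
  proof (rule eventually_mono[OF eventually_gt_at_top[of 0]])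
    fix n :: nat assume "n > 0"
    moreover have "real (n div L) * real L \<le> real n"
      using *[of n] by linarith
    ultimately show "real (n div L) / real n \<le> 1 / real L"
      using assms by (simp add: divide_simps)
  qed
qed

text \<open>Whole blocks of length \<open>L\<close> are counted exactly. Rounding \<open>n\<close>
  down to a multiple of \<open>L\<close> gives the lower bound through \<open>T\<close>, rounding up
  the upper bound through \<open>Z\<close>; incomplete blocks vanish in the limit and are absorbed
  by \<eta>.\<close>

lemma pair_density_bounds:
  assumes L: "L > 0"
    and T: "T \<subseteq> {..<L} \<times> {..<L}" "\<And>i j. (i mod L, j mod L) \<in> T \<Longrightarrow> P i j"
    and Z: "Z \<subseteq> {..<L} \<times> {..<L}" "\<And>i j. P i j \<Longrightarrow> (i mod L, j mod L) \<in> Z"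
    and "\<eta> > 0"
  shows "\<forall>\<^sub>F n in sequentially.
    real (card T) / (real L)\<^sup>2 - \<eta> \<le> pair_density P n \<and> pair_density P n \<le> real (card Z) / (real L)\<^sup>2 + \<eta>"
proof -
  let ?r = "\<lambda>n. real (n div L) / real n"
  have fin: "finite {(i, j). i < n \<and> j < n \<and> Q i j}" for n :: nat and Q
    by (rule finite_subset[of _ "{..<n} \<times> {..<n}"]) auto
  have lower: "(?r n)\<^sup>2 * real (card T) \<le> pair_density P n" for n
  proof -
    have "(n div L) * L \<le> n" by simp
    then have "{(i, j). i < n div L * L \<and> j < n div L * L \<and> (i mod L, j mod L) \<in> T}
        \<subseteq> {(i, j). i < n \<and> j < n \<and> P i j}"
      using T(2) by (auto intro: less_le_trans)
    then have "(n div L)\<^sup>2 * card T \<le> card {(i, j). i < n \<and> j < n \<and> P i j}"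
      by (subst card_residue_pairs[OF L T(1), symmetric]) (rule card_mono[OF fin])
    then have "real ((n div L)\<^sup>2 * card T) \<le> real (card {(i, j). i < n \<and> j < n \<and> P i j})"
      by (rule of_nat_mono)
    then show ?thesis
      by (simp add: pair_density_def power_divide divide_right_mono)
  qed
  have upper: "pair_density P n \<le> (?r n + 1 / real n)\<^sup>2 * real (card Z)" for n
  proof -
    have "n < Suc (n div L) * L"
      using dividend_less_times_div[OF L, of n] by (simp add: algebra_simps)
    then have "{(i, j). i < n \<and> j < n \<and> P i j}
        \<subseteq> {(i, j). i < Suc (n div L) * L \<and> j < Suc (n div L) * L \<and> (i mod L, j mod L) \<in> Z}"
      using Z(2) by auto
    then have "card {(i, j). i < n \<and> j < n \<and> P i j} \<le> (Suc (n div L))\<^sup>2 * card Z"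
      by (subst card_residue_pairs[OF L Z(1), symmetric]) (rule card_mono[OF fin])
    then have "real (card {(i, j). i < n \<and> j < n \<and> P i j}) \<le> real ((Suc (n div L))\<^sup>2 * card Z)"
      by (rule of_nat_mono)
    then have "pair_density P n \<le> real ((Suc (n div L))\<^sup>2 * card Z) / (real n)\<^sup>2"
      unfolding pair_density_def by (rule divide_right_mono) simp
    also have "\<dots> = (?r n + 1 / real n)\<^sup>2 * real (card Z)"
      by (simp add: add_divide_distrib[symmetric] power_divide add.commute)
    finally show ?thesis .
  qed
  have "(\<lambda>n. (?r n)\<^sup>2 * real (card T)) \<longlonglongrightarrow> (1 / real L)\<^sup>2 * real (card T)"
    by (intro tendsto_intros div_ratio_tendsto L)
  then have lo: "\<forall>\<^sub>F n in sequentially. (1 / real L)\<^sup>2 * real (card T) - \<eta> < (?r n)\<^sup>2 * real (card T)"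
    using \<open>\<eta> > 0\<close> by (intro order_tendstoD(1)) auto
  have "(\<lambda>n. (?r n + 1 / real n)\<^sup>2 * real (card Z)) \<longlonglongrightarrow> (1 / real L + 0)\<^sup>2 * real (card Z)"
    by (intro tendsto_intros div_ratio_tendsto L lim_1_over_n)
  then have up: "\<forall>\<^sub>F n in sequentially.
      (?r n + 1 / real n)\<^sup>2 * real (card Z) < (1 / real L)\<^sup>2 * real (card Z) + \<eta>"
    using \<open>\<eta> > 0\<close> by (intro order_tendstoD(2)) auto
  show ?thesis
    using lo up
  proof eventually_elim
    case (elim n)
    then show ?case
      using lower[of n] upper[of n] by (simp add: power_divide)
  qed
qed

lemma pair_density_tendsto_periodic:
  assumes "L > 0" "\<And>i j. P i j \<longleftrightarrow> P (i mod L) (j mod L)"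
  shows "pair_density P \<longlonglongrightarrow> real (card {(a, b). a < L \<and> b < L \<and> P a b}) / (real L)\<^sup>2"
proof (rule tendstoI)
  fix e :: real assume "e > 0"
  let ?T = "{(a, b). a < L \<and> b < L \<and> P a b}"
  have "\<forall>\<^sub>F n in sequentially. real (card ?T) / (real L)\<^sup>2 - e/2 \<le> pair_density P n
      \<and> pair_density P n \<le> real (card ?T) / (real L)\<^sup>2 + e/2"
    using assms \<open>e > 0\<close> by (intro pair_density_bounds) auto
  then show "\<forall>\<^sub>F n in sequentially. dist (pair_density P n) (real (card ?T) / (real L)\<^sup>2) < e"
    by eventually_elim (use \<open>e > 0\<close> in \<open>simp add: dist_real_def abs_less_iff\<close>)
qed

text \<open>The pairs of residue classes modulo \<open>L\<close> that do not decide \<open>P\<close>.\<close>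

definition ambiguous :: "(nat \<Rightarrow> nat \<Rightarrow> bool) \<Rightarrow> nat \<Rightarrow> (nat \<times> nat) set" where
  "ambiguous P L = {(a, b). a < L \<and> b < L \<and>
     (\<exists>i j i' j'. i mod L = a \<and> i' mod L = a \<and> j mod L = b \<and> j' mod L = b \<and> P i j \<and> \<not> P i' j')}"

lemma finite_ambiguous: "finite (ambiguous P L)"
  by (rule finite_subset[of _ "{..<L} \<times> {..<L}"]) (auto simp: ambiguous_def)

text \<open>Modulo \<open>L K\<close> the pairs of classes either force \<open>P\<close>, exclude it
  or are ambiguous. Only the last leave the density undetermined, so their vanishing proportion
  makes it Cauchy without a formula for the limit.\<close>

lemma pair_density_convergent:
  assumes L: "\<And>K. L K > 0"
    and amb: "(\<lambda>K. real (card (ambiguous P (L K))) / (real (L K))\<^sup>2) \<longlonglongrightarrow> 0"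
  shows "convergent (pair_density P)"
proof -
  have "Cauchy (pair_density P)"
  proof (rule metric_CauchyI)
    fix e :: real assume e: "e > 0"
    \<comment> \<open>The densities will lie in a window of width e/4 + 2 * e/8, which is below
      e.\<close>
    have "\<forall>\<^sub>F K in sequentially. real (card (ambiguous P (L K))) / (real (L K))\<^sup>2 < e/4"
      using amb e by (intro order_tendstoD(2)) auto
    then obtain K where K: "real (card (ambiguous P (L K))) / (real (L K))\<^sup>2 < e/4"
      using eventually_happens'[OF sequentially_bot] by blast
    define N where "N = L K"
    define T where "T = {(a, b). a < N \<and> b < N \<and> (\<forall>i j. i mod N = a \<longrightarrow> j mod N = b \<longrightarrow> P i j)}"
    have N: "N > 0" using L by (simp add: N_def)
    have fT: "finite T"
      by (rule finite_subset[of _ "{..<N} \<times> {..<N}"]) (auto simp: T_def)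
    have "\<forall>\<^sub>F n in sequentially. real (card T) / (real N)\<^sup>2 - e/8 \<le> pair_density P n
        \<and> pair_density P n \<le> real (card (T \<union> ambiguous P N)) / (real N)\<^sup>2 + e/8"
    proof (rule pair_density_bounds[OF N])
      show T_sub: "T \<subseteq> {..<N} \<times> {..<N}"
        unfolding T_def by blast
      show "P i j" if "(i mod N, j mod N) \<in> T" for i j
        using that by (simp add: T_def)
      have "ambiguous P N \<subseteq> {..<N} \<times> {..<N}"
        unfolding ambiguous_def by blast
      then show "T \<union> ambiguous P N \<subseteq> {..<N} \<times> {..<N}"
        using T_sub by simp
      show "(i mod N, j mod N) \<in> T \<union> ambiguous P N" if "P i j" for i j
      proof (cases "\<forall>i' j'. i' mod N = i mod N \<longrightarrow> j' mod N = j mod N \<longrightarrow> P i' j'")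
        case True
        then show ?thesis using N by (simp add: T_def)
      next
        case False
        then have "(i mod N, j mod N) \<in> ambiguous P N"
          using that N unfolding ambiguous_def mem_Collect_eq case_prod_conv
          by (metis mod_less_divisor)
        then show ?thesis by simp
      qed
    qed (use e in simp)
    moreover have "real (card (T \<union> ambiguous P N)) / (real N)\<^sup>2 \<le> real (card T) / (real N)\<^sup>2 + e/4"
    proof -
      have "real (card (T \<union> ambiguous P N)) \<le> real (card T) + real (card (ambiguous P N))"
        using card_Un_le[of T "ambiguous P N"] by linarith
      then have "real (card (T \<union> ambiguous P N)) / (real N)\<^sup>2
          \<le> (real (card T) + real (card (ambiguous P N))) / (real N)\<^sup>2"
        by (rule divide_right_mono) simp
      then show ?thesis
        using K unfolding N_def add_divide_distrib by linarith
    qed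
    ultimately have "\<forall>\<^sub>F n in sequentially. real (card T) / (real N)\<^sup>2 - e/8 \<le> pair_density P n
        \<and> pair_density P n \<le> real (card T) / (real N)\<^sup>2 + e/4 + e/8"
      by (auto elim!: eventually_mono)
    then obtain M where M: "\<And>n. n \<ge> M \<Longrightarrow> real (card T) / (real N)\<^sup>2 - e/8 \<le> pair_density P n
        \<and> pair_density P n \<le> real (card T) / (real N)\<^sup>2 + e/4 + e/8"
      unfolding eventually_sequentially by blast
    have "dist (pair_density P m) (pair_density P n) < e" if "m \<ge> M" "n \<ge> M" for m n
      using M[OF that(1)] M[OF that(2)] e unfolding dist_real_def abs_less_iff by linarith
    then show "\<exists>M. \<forall>m\<ge>M. \<forall>n\<ge>M. dist (pair_density P m) (pair_density P n) < e" by blast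
  qed
  then show ?thesis by (simp add: Cauchy_convergent_iff)
qed

text \<open>Translation by \<open>s\<close> permutes the residues modulo \<open>L\<close> and
  carries ambiguous classes to ambiguous classes. This bounds every coordinate of Bowen's metric by
  the one at shift 0.\<close>

lemma card_ambiguous_shift:
  assumes "L > 0"
  shows "card (ambiguous (\<lambda>i j. P (i + s) (j + s)) L) \<le> card (ambiguous P L)"
proof (rule card_inj_on_le[where f = "\<lambda>(a, b). ((a + s) mod L, (b + s) mod L)"])
  have inverse: "((a + s) mod L + (L - s mod L)) mod L = a" if "a < L" for a
  proof -
    have "((a + s) mod L + (L - s mod L)) mod L = (a + (s + (L - s mod L))) mod L"
      by (metis mod_add_left_eq add.assoc)
    also have "s + (L - s mod L) = (s div L + 1) * L"
      unfolding add_mult_distrib mult_1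
      using div_mult_mod_eq[of s L] mod_less_divisor[OF assms, of s] by linarith
    finally show ?thesis using that by (simp only: mod_mult_self1 mod_less)
  qed
  have inj: "a = a'" if "(a + s) mod L = (a' + s) mod L" "a < L" "a' < L" for a a'
    using inverse[of a] inverse[of a'] that by simp
  show "inj_on (\<lambda>(a, b). ((a + s) mod L, (b + s) mod L)) (ambiguous (\<lambda>i j. P (i + s) (j + s)) L)"
  proof (rule inj_onI, clarify)
    fix a b a' b'
    assume "(a, b) \<in> ambiguous (\<lambda>i j. P (i + s) (j + s)) L"
      "(a', b') \<in> ambiguous (\<lambda>i j. P (i + s) (j + s)) L"
      "(a + s) mod L = (a' + s) mod L" "(b + s) mod L = (b' + s) mod L"
    then show "a = a' \<and> b = b'"
      using inj[of a a'] inj[of b b'] unfolding ambiguous_def by blast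
  qed
  show "(\<lambda>(a, b). ((a + s) mod L, (b + s) mod L)) ` ambiguous (\<lambda>i j. P (i + s) (j + s)) L
      \<subseteq> ambiguous P L"
  proof clarify
    fix a b
    assume "(a, b) \<in> ambiguous (\<lambda>i j. P (i + s) (j + s)) L"
    then obtain i j i' j' where "i mod L = a" "i' mod L = a" "j mod L = b" "j' mod L = b"
      "P (i + s) (j + s)" "\<not> P (i' + s) (j' + s)"
      unfolding ambiguous_def by blast
    moreover from this have "(i + s) mod L = (a + s) mod L" "(i' + s) mod L = (a + s) mod L"
      "(j + s) mod L = (b + s) mod L" "(j' + s) mod L = (b + s) mod L"
      by (metis mod_add_left_eq)+
    ultimately show "((a + s) mod L, (b + s) mod L) \<in> ambiguous P L"
      using assms unfolding ambiguous_def mem_Collect_eq case_prod_conv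
      by (meson mod_less_divisor)
  qed
qed (rule finite_ambiguous)

lemma ambiguous_Ball:
  "ambiguous (\<lambda>i j. \<forall>s<m. P s i j) L \<subseteq> (\<Union>s<m. ambiguous (P s) L)"
  unfolding ambiguous_def by blast

text \<open>Each half-open cell of length \<delta>, counted from \<open>p\<close>, contains at most
  one point of \<open>S\<close>.\<close>

lemma card_separated_le:
  fixes S :: "real set"
  assumes "\<delta> > 0" "S \<subseteq> {p..q}" "\<And>x y. x \<in> S \<Longrightarrow> y \<in> S \<Longrightarrow> x \<noteq> y \<Longrightarrow> \<delta> \<le> \<bar>x - y\<bar>"
  shows "finite S" "card S \<le> nat \<lfloor>(q - p) / \<delta>\<rfloor> + 1"
proof -
  let ?h = "\<lambda>x. nat \<lfloor>(x - p) / \<delta>\<rfloor>"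
  have inj: "inj_on ?h S"
  proof (rule inj_onI, rule ccontr)
    fix x y assume xy: "x \<in> S" "y \<in> S" "?h x = ?h y" "x \<noteq> y"
    have "0 \<le> (x - p) / \<delta>" "0 \<le> (y - p) / \<delta>"
      using assms(1,2) xy(1,2) by auto
    then have "\<lfloor>(x - p) / \<delta>\<rfloor> = \<lfloor>(y - p) / \<delta>\<rfloor>"
      using xy(3) by (metis nat_eq_iff zero_le_floor)
    then have "\<bar>(x - p) / \<delta> - (y - p) / \<delta>\<bar> < 1"
      by linarith
    then have "\<bar>x - y\<bar> < \<delta>"
      using assms(1) by (simp add: diff_divide_distrib[symmetric] abs_divide)
    then show False
      using assms(3)[OF xy(1,2,4)] by simp
  qed
  have img: "?h ` S \<subseteq> {.. nat \<lfloor>(q - p) / \<delta>\<rfloor>}"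
    using assms(1,2) by (auto intro!: nat_mono floor_mono divide_right_mono)
  show "finite S"
    by (rule inj_on_finite[OF inj img]) simp
  show "card S \<le> nat \<lfloor>(q - p) / \<delta>\<rfloor> + 1"
    using card_inj_on_le[OF inj img] by simp
qed

section \<open>Entropy and Li-Yorke pairs at a fixed scale\<close>

text \<open>A cover by \<open>K\<close> sets of diameter at most \<epsilon> in Bowen's metric of
  order \<open>n\<close>, encoded as a colouring: colourings compose with maps and combine on unions
  without families of sets.\<close>

definition covered :: "(real \<Rightarrow> real) \<Rightarrow> nat \<Rightarrow> real \<Rightarrow> real set \<Rightarrow> nat \<Rightarrow> bool" where
  "covered F n \<epsilon> S K \<longleftrightarrow> (\<exists>c :: real \<Rightarrow> nat. (\<forall>x\<in>S. c x < K) \<and>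
     (\<forall>x\<in>S. \<forall>y\<in>S. c x = c y \<longrightarrow> (\<forall>i<n. \<bar>(F ^^ i) x - (F ^^ i) y\<bar> \<le> \<epsilon>)))"

definition poly_covered :: "(real \<Rightarrow> real) \<Rightarrow> real \<Rightarrow> bool" where
  "poly_covered F \<epsilon> \<longleftrightarrow> (\<exists>C d. \<forall>n. covered F n \<epsilon> {0..1} (C * (n + 1) ^ d))"

lemma covered_pullback:
  assumes "covered g n' \<epsilon>' T K" "\<And>x. x \<in> S \<Longrightarrow> h x \<in> T"
    and "\<And>x y i. \<lbrakk>x \<in> S; y \<in> S; \<And>i. i < n' \<Longrightarrow> \<bar>(g ^^ i) (h x) - (g ^^ i) (h y)\<bar> \<le> \<epsilon>'; i < n\<rbrakk>
      \<Longrightarrow> \<bar>(F ^^ i) x - (F ^^ i) y\<bar> \<le> \<epsilon>"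
  shows "covered F n \<epsilon> S K"
proof -
  obtain c where "\<forall>x\<in>T. c x < K"
    "\<forall>x\<in>T. \<forall>y\<in>T. c x = c y \<longrightarrow> (\<forall>i<n'. \<bar>(g ^^ i) x - (g ^^ i) y\<bar> \<le> \<epsilon>')"
    using assms(1) unfolding covered_def by blast
  with assms(2,3) show ?thesis
    unfolding covered_def by (intro exI[of _ "\<lambda>x. c (h x)"]) blast
qed

lemma covered_mono:
  assumes "covered F n \<epsilon> S K" "n' \<le> n" "S' \<subseteq> S" "K \<le> K'"
  shows "covered F n' \<epsilon> S' K'"
proof -
  obtain c where "\<forall>x\<in>S. c x < K"
    "\<forall>x\<in>S. \<forall>y\<in>S. c x = c y \<longrightarrow> (\<forall>i<n. \<bar>(F ^^ i) x - (F ^^ i) y\<bar> \<le> \<epsilon>)"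
    using assms(1) unfolding covered_def by blast
  with assms(2-4) show ?thesis
    unfolding covered_def by (intro exI[of _ c]) (meson less_le_trans subset_iff)
qed

lemma covered_Un:
  assumes "covered F n \<epsilon> S K" "covered F n \<epsilon> T L"
  shows "covered F n \<epsilon> (S \<union> T) (K + L)"
proof -
  obtain c where c: "\<forall>x\<in>S. c x < K"
    "\<forall>x\<in>S. \<forall>y\<in>S. c x = c y \<longrightarrow> (\<forall>i<n. \<bar>(F ^^ i) x - (F ^^ i) y\<bar> \<le> \<epsilon>)"
    using assms(1) unfolding covered_def by blast
  obtain b where b: "\<forall>x\<in>T. b x < L"
    "\<forall>x\<in>T. \<forall>y\<in>T. b x = b y \<longrightarrow> (\<forall>i<n. \<bar>(F ^^ i) x - (F ^^ i) y\<bar> \<le> \<epsilon>)"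
    using assms(2) unfolding covered_def by blast
  define a where "a x = (if x \<in> S then c x else K + b x)" for x
  have "\<forall>x\<in>S \<union> T. a x < K + L"
    using b(1) c(1) by (auto simp: a_def intro: trans_less_add1)
  moreover have "x \<in> S \<and> y \<in> S \<and> c x = c y \<or> x \<in> T \<and> y \<in> T \<and> b x = b y"
    if "x \<in> S \<union> T" "y \<in> S \<union> T" "a x = a y" for x y
    using that c(1) by (fastforce simp: a_def split: if_splits)
  ultimately show ?thesis
    unfolding covered_def using b(2) c(2) by (intro exI[of _ a]) blast
qed

lemma card_separated_le_covered:
  assumes "separated_set S F n \<epsilon> E" "covered F n \<epsilon> S K" "n > 0"
  shows "card E \<le> K"
proof -
  obtain c where c: "\<forall>x\<in>S. c x < K"
    "\<forall>x\<in>S. \<forall>y\<in>S. c x = c y \<longrightarrow> (\<forall>i<n. \<bar>(F ^^ i) x - (F ^^ i) y\<bar> \<le> \<epsilon>)"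
    using assms(2) unfolding covered_def by blast
  have E: "E \<subseteq> S" "\<And>u v. u \<in> E \<Longrightarrow> v \<in> E \<Longrightarrow> u \<noteq> v \<Longrightarrow> bowen_dist F n u v > \<epsilon>"
    using assms(1) unfolding separated_set_def by auto
  have "inj_on c E"
  proof (rule inj_onI, rule ccontr)
    fix u v assume uv: "u \<in> E" "v \<in> E" "c u = c v" "u \<noteq> v"
    then have "\<forall>i<n. \<bar>(F ^^ i) u - (F ^^ i) v\<bar> \<le> \<epsilon>"
      using c(2) E(1) by blast
    then have "bowen_dist F n u v \<le> \<epsilon>"
      unfolding bowen_dist_def using \<open>n > 0\<close> by (subst Max_le_iff) (auto simp: dist_real_def)
    then show False using E(2)[OF uv(1,2,4)] by simp
  qed
  moreover have "c ` E \<subseteq> {..<K}"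
    using c(1) E(1) by blast
  ultimately show ?thesis
    using card_inj_on_le[of c E "{..<K}"] by simp
qed

text \<open>A polynomial cover bounds the logarithm of the size of a separated set by a constant
  plus a multiple of \<open>ln (n + 1)\<close>, which is negligible against \<open>n\<close>. The
  opposite inequality comes from a singleton.\<close>

lemma topological_entropy_eq_0:
  assumes "\<And>\<epsilon>. \<epsilon> > 0 \<Longrightarrow> poly_covered F \<epsilon>"
  shows "topological_entropy {0..1} F = 0"
proof (rule antisym)
  let ?s = "\<lambda>\<epsilon> n. SUP E \<in> {E. separated_set {0..1} F n \<epsilon> E}. ereal (ln (real (card E)))"
  show "topological_entropy {0..1} F \<le> 0"
    unfolding topological_entropy_def
  proof (rule SUP_least)
    fix \<epsilon> :: real assume "\<epsilon> \<in> {0<..}"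
    then obtain C d where C: "\<And>n. covered F n \<epsilon> {0..1} (C * (n + 1) ^ d)"
      using assms unfolding poly_covered_def greaterThan_iff by blast
    define b where "b n = (ln (real (Suc C)) + real d * ln (real (n + 1))) / real n" for n :: nat
    have "?s \<epsilon> n / ereal (real n) \<le> ereal (b n)" if "n > 0" for n
    proof -
      have "?s \<epsilon> n \<le> ereal (ln (real (Suc C)) + real d * ln (real (n + 1)))"
      proof (rule SUP_least)
        fix E assume "E \<in> {E. separated_set {0..1} F n \<epsilon> E}"
        then have "card E \<le> C * (n + 1) ^ d"
          using card_separated_le_covered[OF _ C that] by simp
        \<comment> \<open>\<open>Suc C\<close> makes the bound at least 1, so its logarithm splits
          and also dominates the default \<open>ln 0 = 0\<close> of the empty set.\<close>
        also have "\<dots> \<le> Suc C * (n + 1) ^ d" by simp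
        finally have le: "real (card E) \<le> real (Suc C) * real (n + 1) ^ d"
          by (metis of_nat_le_iff of_nat_mult of_nat_power)
        have "ln (real (card E)) \<le> ln (real (Suc C) * real (n + 1) ^ d)"
        proof (cases "card E = 0")
          case True
          have "1 * 1 \<le> real (Suc C) * real (n + 1) ^ d"
            by (intro mult_mono one_le_power) auto
          then show ?thesis using True by simp
        next
          case False
          then show ?thesis using le by (intro ln_mono) auto
        qed
        also have "\<dots> = ln (real (Suc C)) + real d * ln (real (n + 1))"
          by (subst ln_mult_pos) (auto simp: ln_realpow)
        finally show "ereal (ln (real (card E))) \<le> ereal (ln (real (Suc C)) + real d * ln (real (n + 1)))"
          by simp
      qed
      then have "?s \<epsilon> n / ereal (real n)
          \<le> ereal (ln (real (Suc C)) + real d * ln (real (n + 1))) / ereal (real n)"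
        by (rule ereal_divide_right_mono) (use that in simp)
      then show ?thesis using that by (simp add: b_def)
    qed
    then have "limsup (\<lambda>n. ?s \<epsilon> n / ereal (real n)) \<le> limsup (\<lambda>n. ereal (b n))"
      by (intro Limsup_mono eventually_mono[OF eventually_gt_at_top[of 0]])
    also have "\<dots> = 0"
    proof (rule lim_imp_Limsup)
      have "b \<longlonglongrightarrow> 0"
        unfolding b_def by real_asymp
      then show "(\<lambda>n. ereal (b n)) \<longlonglongrightarrow> 0"
        by (simp add: zero_ereal_def)
    qed simp
    finally show "limsup (\<lambda>n. ?s \<epsilon> n / ereal (real n)) \<le> 0" .
  qed
  have "0 \<le> ?s 1 n / ereal (real n)" for n
  proof -
    have "separated_set {0..1} F n 1 {0}"
      by (simp add: separated_set_def)
    then have "ereal (ln (real (card {0::real}))) \<le> ?s 1 n"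
      by (intro SUP_upper) simp
    then show ?thesis by (intro zero_le_divide_ereal) (auto simp: zero_ereal_def)
  qed
  then have "0 \<le> limsup (\<lambda>n. ?s 1 n / ereal (real n))"
    using Limsup_mono[of "\<lambda>_. 0" "\<lambda>n. ?s 1 n / ereal (real n)" sequentially]
    by (simp add: Limsup_const)
  then show "0 \<le> topological_entropy {0..1} F"
    unfolding topological_entropy_def by (rule SUP_upper2[rotated]) simp
qed

text \<open>The negation of being a Li-Yorke pair, seen at scale \<open>\<epsilon>\<close>.\<close>

definition settled :: "(real \<Rightarrow> real) \<Rightarrow> real \<Rightarrow> real \<Rightarrow> real \<Rightarrow> bool" where
  "settled g \<epsilon> u v \<longleftrightarrow> (\<forall>\<^sub>F n in sequentially. \<bar>(g ^^ n) u - (g ^^ n) v\<bar> \<le> \<epsilon>) \<or>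
     (\<exists>\<delta>>0. \<forall>\<^sub>F n in sequentially. \<delta> \<le> \<bar>(g ^^ n) u - (g ^^ n) v\<bar>)"

lemma settled_sym: "settled g \<epsilon> u v \<longleftrightarrow> settled g \<epsilon> v u"
  by (simp add: settled_def abs_minus_commute)

definition tame :: "(real \<Rightarrow> real) \<Rightarrow> real \<Rightarrow> bool" where
  "tame g \<epsilon> \<longleftrightarrow> (\<exists>R\<subseteq>{0..1}. countable ({0..1} - R) \<and> (\<forall>u\<in>R. g u \<in> R) \<and>
     (\<forall>u\<in>R. \<forall>v\<in>R. settled g \<epsilon> u v))"

text \<open>Two points of a scrambled set outside all exceptional sets are settled at every scale
  \<open>e k\<close>. Their lower limit 0 excludes the second alternative, so the upper limit is at
  most \<open>e k\<close> for all \<open>k\<close>.\<close>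

lemma not_Li_Yorke_chaotic:
  assumes "\<And>k. tame F (e k)" "e \<longlonglongrightarrow> 0"
  shows "\<not> Li_Yorke_chaotic {0..1} F"
proof
  assume "Li_Yorke_chaotic {0..1} F"
  then obtain S where S: "S \<subseteq> {0..1}" "uncountable S"
    and LY: "\<And>u v. u \<in> S \<Longrightarrow> v \<in> S \<Longrightarrow> u \<noteq> v \<Longrightarrow>
      liminf (\<lambda>n. ereal (dist ((F ^^ n) u) ((F ^^ n) v))) = 0 \<and>
      limsup (\<lambda>n. ereal (dist ((F ^^ n) u) ((F ^^ n) v))) > 0"
    unfolding Li_Yorke_chaotic_def by blast
  have "\<exists>R. countable ({0..1} - R) \<and> (\<forall>u\<in>R. \<forall>v\<in>R. settled F (e k) u v)" for k
    using assms(1)[of k] unfolding tame_def by blast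
  then obtain R where R: "\<And>k. countable ({0..1} - R k)"
    "\<And>k u v. u \<in> R k \<Longrightarrow> v \<in> R k \<Longrightarrow> settled F (e k) u v"
    by metis
  let ?Q = "\<Union>k. {0..1} - R k"
  have "countable ?Q"
    by (intro countable_UN R(1)) simp
  then have unc: "uncountable (S - ?Q)"
    using S(2) by (simp add: uncountable_minus_countable)
  then obtain u where u: "u \<in> S - ?Q"
    by (metis countable_empty ex_in_conv)
  have "S - ?Q - {u} \<noteq> {}"
    using unc by (metis countable_empty countable_Diff_eq)
  then obtain v where v: "v \<in> S - ?Q" "v \<noteq> u"
    by blast
  have uv: "u \<in> S" "v \<in> S" "u \<noteq> v" "u \<notin> ?Q" "v \<notin> ?Q"
    using u v by simp_all
  then have uvR: "u \<in> R k" "v \<in> R k" for k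
    using S(1) by auto
  let ?d = "\<lambda>n. \<bar>(F ^^ n) u - (F ^^ n) v\<bar>"
  have LY': "liminf (\<lambda>n. ereal (?d n)) = 0" "limsup (\<lambda>n. ereal (?d n)) > 0"
    using LY[OF uv(1-3)] by (simp_all add: dist_real_def)
  have "limsup (\<lambda>n. ereal (?d n)) \<le> ereal (e k)" for k
    using R(2)[OF uvR[of k], unfolded settled_def]
  proof
    assume "\<forall>\<^sub>F n in sequentially. ?d n \<le> e k"
    then show ?thesis
      by (intro Limsup_bounded) (auto elim: eventually_mono)
  next
    assume "\<exists>\<delta>>0. \<forall>\<^sub>F n in sequentially. \<delta> \<le> ?d n"
    then obtain \<delta> where \<delta>: "\<delta> > 0" "\<forall>\<^sub>F n in sequentially. \<delta> \<le> ?d n" by blast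
    then have "ereal \<delta> \<le> liminf (\<lambda>n. ereal (?d n))"
      by (intro Liminf_bounded) (auto elim: eventually_mono)
    then show ?thesis using LY'(1) \<delta>(1) by simp
  qed
  moreover have "(\<lambda>k. ereal (e k)) \<longlonglongrightarrow> 0"
    using assms(2) by (simp add: zero_ereal_def)
  ultimately have "limsup (\<lambda>n. ereal (?d n)) \<le> 0"
    by (intro LIMSEQ_le_const) auto
  then show False using LY'(2) by simp
qed

section \<open>Renormalization\<close>

text \<open>The middle interval is split by the time at which a point leaves it, which costs one copy of the
  cover of \<open>T\<close> per exit time. For points that stay it suffices to subdivide their last position into
  cells of length \<open>\<epsilon>\<close>, since \<open>F\<close> expands distances there.\<close>

lemma covered_middle:
  fixes a b :: real
  assumes mid: "{a..b} \<subseteq> {0..1}"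
    and expand: "\<And>x y. x \<in> {a..b} \<Longrightarrow> y \<in> {a..b} \<Longrightarrow> \<bar>x - y\<bar> \<le> \<bar>F x - F y\<bar>"
    and maps: "\<And>x. x \<in> {a..b} \<Longrightarrow> F x \<in> {a..b} \<union> T"
    and cov: "covered F N \<epsilon> T K" and "\<epsilon> > 0" and "n \<le> N"
  shows "covered F n \<epsilon> {a..b} (nat \<lfloor>1/\<epsilon>\<rfloor> + 1 + n * K)"
  using \<open>n \<le> N\<close>
proof (induction n)
  case 0
  then show ?case
    unfolding covered_def by (intro exI[of _ "\<lambda>_. 0"]) simp
next
  case (Suc n)
  show ?case
  \<comment> \<open>A single time is covered by cells; for more times, closeness at time 1 implies
    closeness at time 0 by expansion.\<close>
  proof (cases "n = 0")
    case True
    let ?c = "\<lambda>x. nat \<lfloor>x/\<epsilon>\<rfloor>"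
    have "?c x < nat \<lfloor>1/\<epsilon>\<rfloor> + 1" if "x \<in> {a..b}" for x
    proof -
      have "x / \<epsilon> \<le> 1 / \<epsilon>"
        using that mid \<open>\<epsilon> > 0\<close> by (intro divide_right_mono) auto
      then have "?c x \<le> nat \<lfloor>1/\<epsilon>\<rfloor>" by (intro nat_mono floor_mono)
      then show ?thesis by simp
    qed
    moreover have "\<bar>x - y\<bar> \<le> \<epsilon>" if "x \<in> {a..b}" "y \<in> {a..b}" "?c x = ?c y" for x y
    proof -
      have "0 \<le> x / \<epsilon>" "0 \<le> y / \<epsilon>"
        using that(1,2) mid \<open>\<epsilon> > 0\<close> by auto
      then have "\<lfloor>x / \<epsilon>\<rfloor> = \<lfloor>y / \<epsilon>\<rfloor>"
        using that(3) by (metis nat_eq_iff zero_le_floor)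
      then have "\<bar>x / \<epsilon> - y / \<epsilon>\<bar> \<le> 1" by linarith
      then show ?thesis
        using \<open>\<epsilon> > 0\<close> by (simp add: diff_divide_distrib[symmetric] abs_divide)
    qed
    ultimately have "covered F (Suc n) \<epsilon> {a..b} (nat \<lfloor>1/\<epsilon>\<rfloor> + 1)"
      unfolding covered_def True by (intro exI[of _ ?c]) auto
    then show ?thesis
      by (rule covered_mono) auto
  next
    case False
    have pull: "covered F (Suc n) \<epsilon> {x \<in> {a..b}. F x \<in> U} L" if "covered F n \<epsilon> U L" for U L
    proof (rule covered_pullback[OF that, where h = F])
      fix x y i
      assume x: "x \<in> {x \<in> {a..b}. F x \<in> U}" and y: "y \<in> {x \<in> {a..b}. F x \<in> U}"
        and close: "\<And>i. i < n \<Longrightarrow> \<bar>(F ^^ i) (F x) - (F ^^ i) (F y)\<bar> \<le> \<epsilon>" and i: "i < Suc n"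
      show "\<bar>(F ^^ i) x - (F ^^ i) y\<bar> \<le> \<epsilon>"
      proof (cases i)
        case 0
        then show ?thesis
          using close[of 0] expand[of x y] x y False by simp
      next
        case (Suc j)
        then show ?thesis
          using close[of j] i by (simp add: funpow_Suc_right del: funpow.simps)
      qed
    qed simp
    have "covered F (Suc n) \<epsilon> ({x \<in> {a..b}. F x \<in> {a..b}} \<union> {x \<in> {a..b}. F x \<in> T})
        ((nat \<lfloor>1/\<epsilon>\<rfloor> + 1 + n * K) + K)"
      by (rule covered_Un[OF pull[OF Suc.IH] pull[OF covered_mono[OF cov]]]) (use Suc.prems in auto)
    then show ?thesis
      by (rule covered_mono) (simp, use maps in blast, simp)
  qed
qed

text \<open>\<open>F\<close> exchanges \<open>[0, \<alpha>]\<close> and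
  \<open>[1 - \<beta>, 1]\<close>, and its square acts on both as a rescaled \<open>g\<close>; in
  between it is affine with slope \<open>-\<kappa>\<close>. The bound 1/3 on both ratios turns
  closeness \<open>3 * \<epsilon>\<close> for \<open>g\<close> into closeness \<epsilon> for
  \<open>F\<close>.\<close>

locale renormalization =
  fixes F g :: "real \<Rightarrow> real" and \<alpha> \<beta> \<kappa> :: real
  assumes scales: "0 < \<beta>" "\<beta> \<le> \<alpha>" "\<alpha> \<le> 1/3"
    and expanding: "1 < \<kappa>"
    and g_unit: "x \<in> {0..1} \<Longrightarrow> g x \<in> {0..1}"
    and F_left: "t \<in> {0..1} \<Longrightarrow> F (\<alpha> * t) = 1 - \<beta> + \<beta> * t"
    and F_right: "t \<in> {0..1} \<Longrightarrow> F (1 - \<beta> + \<beta> * t) = \<alpha> * g t"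
    and F_middle: "x \<in> {\<alpha>..1-\<beta>} \<Longrightarrow> y \<in> {\<alpha>..1-\<beta>} \<Longrightarrow> F x - F y = \<kappa> * (y - x)"
begin

lemma unit_cases [consumes 1, case_names left right middle]:
  assumes "x \<in> {0..1}"
  obtains t where "t \<in> {0..1}" "x = \<alpha> * t"
  | t where "t \<in> {0..1}" "x = 1 - \<beta> + \<beta> * t"
  | "x \<in> {\<alpha>..1-\<beta>}"
proof -
  consider "x \<le> \<alpha>" | "x \<ge> 1 - \<beta>" | "x \<in> {\<alpha>..1-\<beta>}" by fastforce
  then show ?thesis
  proof cases
    case 1
    then show ?thesis using assms scales by (intro that(1)[of "x / \<alpha>"]) auto
  next
    case 2
    then show ?thesis using assms scales
      by (intro that(2)[of "(x - (1 - \<beta>)) / \<beta>"]) (auto simp: field_simps)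
  qed (rule that(3))
qed

lemma left_mem: "t \<in> {0..1} \<Longrightarrow> \<alpha> * t \<in> {0..\<alpha>}"
  using scales mult_left_le[of t \<alpha>] by auto

lemma right_mem: "t \<in> {0..1} \<Longrightarrow> 1 - \<beta> + \<beta> * t \<in> {1-\<beta>..1}"
  using scales mult_left_le[of t \<beta>] by auto

lemma left_unit: "t \<in> {0..1} \<Longrightarrow> \<alpha> * t \<in> {0..1}"
  using left_mem[of t] scales unfolding atLeastAtMost_iff by linarith

lemma right_unit: "t \<in> {0..1} \<Longrightarrow> 1 - \<beta> + \<beta> * t \<in> {0..1}"
  using right_mem[of t] scales unfolding atLeastAtMost_iff by linarith

lemma F_unit:
  assumes "x \<in> {0..1}"
  shows "F x \<in> {0..1}"
  using assms
proof (cases x rule: unit_cases)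
  case (left t)
  then show ?thesis using right_unit F_left by simp
next
  case (right t)
  then show ?thesis using left_unit g_unit F_right by simp
next
  case middle
  \<comment> \<open>\<open>F\<close> decreases on the middle interval from
    \<open>F \<alpha> = 1\<close> to \<open>F (1 - \<beta>) = \<alpha> * g 0\<close>.\<close>
  have "0 \<le> \<kappa> * (x - \<alpha>)" "0 \<le> \<kappa> * (1 - \<beta> - x)"
    using middle expanding by auto
  then show ?thesis
    using F_middle[of \<alpha> x] F_middle[of x "1 - \<beta>"] F_left[of 1] F_right[of 0] middle scales
      left_unit[OF g_unit, of 0] by auto
qed

lemma F_iter_unit: "x \<in> {0..1} \<Longrightarrow> (F ^^ n) x \<in> {0..1}"
  using F_unit by (induction n) (simp_all del: atLeastAtMost_iff)

lemma g_iter_unit: "x \<in> {0..1} \<Longrightarrow> (g ^^ n) x \<in> {0..1}"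
  using g_unit by (induction n) (simp_all del: atLeastAtMost_iff)

lemma left_even: "t \<in> {0..1} \<Longrightarrow> (F ^^ (2 * n)) (\<alpha> * t) = \<alpha> * (g ^^ n) t"
  using g_iter_unit by (induction n) (simp_all add: F_left F_right del: atLeastAtMost_iff)

lemma left_odd: "t \<in> {0..1} \<Longrightarrow> (F ^^ (2 * n + 1)) (\<alpha> * t) = 1 - \<beta> + \<beta> * (g ^^ n) t"
  using g_iter_unit by (simp add: left_even F_left del: atLeastAtMost_iff)

lemma right_even: "t \<in> {0..1} \<Longrightarrow> (F ^^ (2 * n)) (1 - \<beta> + \<beta> * t) = 1 - \<beta> + \<beta> * (g ^^ n) t"
  using left_odd[of t n] by (simp add: F_left funpow_swap1 del: atLeastAtMost_iff)

text \<open>From the right, the first step already applies \<open>g\<close>, hence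
  \<open>Suc n\<close> here against \<open>n\<close> in \<open>left_odd\<close>.\<close>

lemma right_odd: "t \<in> {0..1} \<Longrightarrow> (F ^^ (2 * n + 1)) (1 - \<beta> + \<beta> * t) = \<alpha> * (g ^^ Suc n) t"
  using g_iter_unit by (simp add: right_even F_right del: atLeastAtMost_iff)

lemma contract_left:
  assumes "d \<le> 3 * \<epsilon>" "0 \<le> d"
  shows "\<alpha> * d \<le> \<epsilon>" "\<beta> * d \<le> \<epsilon>"
proof -
  have "\<alpha> * d \<le> 1/3 * d" "\<beta> * d \<le> 1/3 * d"
    using scales assms by (intro mult_right_mono; simp)+
  then show "\<alpha> * d \<le> \<epsilon>" "\<beta> * d \<le> \<epsilon>" using assms by linarith+
qed

lemma scaled_dist: "\<bar>\<alpha> * s - \<alpha> * t\<bar> = \<alpha> * \<bar>s - t\<bar>"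
  "\<bar>(1 - \<beta> + \<beta> * s) - (1 - \<beta> + \<beta> * t)\<bar> = \<beta> * \<bar>s - t\<bar>"
  using scales by (simp_all add: abs_mult flip: right_diff_distrib)

text \<open>Time \<open>i\<close> of \<open>F\<close> shows time \<open>i div 2\<close> of
  \<open>g\<close>, contracted at least threefold.\<close>

lemma covered_left:
  assumes "covered g n (3 * \<epsilon>) {0..1} K"
  shows "covered F n \<epsilon> {0..\<alpha>} K"
proof (rule covered_pullback[OF assms, where h = "\<lambda>x. x / \<alpha>"])
  show "x / \<alpha> \<in> {0..1}" if "x \<in> {0..\<alpha>}" for x
    using that scales by auto
  fix x y i
  assume xy: "x \<in> {0..\<alpha>}" "y \<in> {0..\<alpha>}" and i: "i < n"
    and close: "\<And>i. i < n \<Longrightarrow> \<bar>(g ^^ i) (x / \<alpha>) - (g ^^ i) (y / \<alpha>)\<bar> \<le> 3 * \<epsilon>"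
  define s t where "s = x / \<alpha>" "t = y / \<alpha>"
  have st: "x = \<alpha> * s" "y = \<alpha> * t" "s \<in> {0..1}" "t \<in> {0..1}"
    using xy scales by (auto simp: s_t_def)
  have *: "\<bar>(g ^^ (i div 2)) s - (g ^^ (i div 2)) t\<bar> \<le> 3 * \<epsilon>"
    using close[of "i div 2"] i by (simp add: s_t_def)
  show "\<bar>(F ^^ i) x - (F ^^ i) y\<bar> \<le> \<epsilon>"
  proof (cases "even i")
    case True
    then have i2: "i = 2 * (i div 2)" by simp
    show ?thesis
      by (subst (1 2) i2, unfold st left_even[OF st(3)] left_even[OF st(4)] scaled_dist)
        (rule contract_left[OF *], simp_all)
  next
    case False
    then have i2: "i = 2 * (i div 2) + 1" by simp
    show ?thesis
      by (subst (1 2) i2, unfold st left_odd[OF st(3)] left_odd[OF st(4)] scaled_dist)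
        (rule contract_left[OF *], simp_all)
  qed
qed

lemma covered_right:
  assumes "covered g n (3 * \<epsilon>) {0..1} K"
  shows "covered F n \<epsilon> {1-\<beta>..1} K"
proof (rule covered_pullback[OF assms, where h = "\<lambda>x. (x - (1 - \<beta>)) / \<beta>"])
  show "(x - (1 - \<beta>)) / \<beta> \<in> {0..1}" if "x \<in> {1-\<beta>..1}" for x
    using that scales by auto
  fix x y i
  assume xy: "x \<in> {1-\<beta>..1}" "y \<in> {1-\<beta>..1}" and i: "i < n"
    and close: "\<And>i. i < n \<Longrightarrow>
      \<bar>(g ^^ i) ((x - (1 - \<beta>)) / \<beta>) - (g ^^ i) ((y - (1 - \<beta>)) / \<beta>)\<bar> \<le> 3 * \<epsilon>"
  define s t where "s = (x - (1 - \<beta>)) / \<beta>" "t = (y - (1 - \<beta>)) / \<beta>"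
  have st: "x = 1 - \<beta> + \<beta> * s" "y = 1 - \<beta> + \<beta> * t" "s \<in> {0..1}" "t \<in> {0..1}"
    using xy scales by (auto simp: s_t_def)
  \<comment> \<open>All \<open>j \<le> i\<close> are provided because odd times on the right read
    \<open>g\<close> at time \<open>Suc (i div 2)\<close>.\<close>
  have *: "\<bar>(g ^^ j) s - (g ^^ j) t\<bar> \<le> 3 * \<epsilon>" if "j \<le> i" for j
    using close[of j] i that by (simp add: s_t_def)
  show "\<bar>(F ^^ i) x - (F ^^ i) y\<bar> \<le> \<epsilon>"
  proof (cases "even i")
    case True
    then have i2: "i = 2 * (i div 2)" by simp
    show ?thesis
      by (subst (1 2) i2, unfold st right_even[OF st(3)] right_even[OF st(4)] scaled_dist)
        (rule contract_left[OF *], simp_all)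
  next
    case False
    then have i2: "i = 2 * (i div 2) + 1" by simp
    then have "Suc (i div 2) \<le> i" by linarith
    then show ?thesis
      by (subst (1 2) i2, unfold st right_odd[OF st(3)] right_odd[OF st(4)] scaled_dist)
        (rule contract_left[OF *], simp_all)
  qed
qed

lemma middle_expand:
  assumes "x \<in> {\<alpha>..1-\<beta>}" "y \<in> {\<alpha>..1-\<beta>}"
  shows "\<bar>F x - F y\<bar> = \<kappa> * \<bar>x - y\<bar>"
  using F_middle[OF assms] expanding by (simp add: abs_mult abs_minus_commute)

text \<open>Both sides inherit the cover of \<open>g\<close>, and the middle adds \<open>n\<close>
  copies of it and a constant, so the degree rises by one.\<close>

lemma poly_covered_step:
  assumes "poly_covered g (3 * \<epsilon>)" "\<epsilon> > 0"
  shows "poly_covered F \<epsilon>"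
proof -
  obtain C d where C: "\<And>n. covered g n (3 * \<epsilon>) {0..1} (C * (n + 1) ^ d)"
    using assms(1) unfolding poly_covered_def by blast
  let ?M = "nat \<lfloor>1/\<epsilon>\<rfloor> + 1"
  have "covered F n \<epsilon> {0..1} ((?M + 2 * C) * (n + 1) ^ Suc d)" for n
  proof -
    let ?P = "(n + 1) ^ d"
    let ?K = "C * ?P + C * ?P"
    have sides: "covered F n \<epsilon> ({0..\<alpha>} \<union> {1-\<beta>..1}) ?K"
      by (intro covered_Un covered_left covered_right C)
    have mid: "covered F n \<epsilon> {\<alpha>..1-\<beta>} (?M + n * ?K)"
    proof (rule covered_middle[OF _ _ _ sides \<open>\<epsilon> > 0\<close> order_refl])
      show "\<bar>x - y\<bar> \<le> \<bar>F x - F y\<bar>" if "x \<in> {\<alpha>..1-\<beta>}" "y \<in> {\<alpha>..1-\<beta>}" for x y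
        using middle_expand[OF that] expanding mult_right_mono[of 1 \<kappa> "\<bar>x - y\<bar>"] by simp
      show "F x \<in> {\<alpha>..1-\<beta>} \<union> ({0..\<alpha>} \<union> {1-\<beta>..1})" if "x \<in> {\<alpha>..1-\<beta>}" for x
        using that F_unit[of x] scales by auto
    qed (use scales in auto)
    show ?thesis
    proof (rule covered_mono[OF covered_Un[OF sides mid]])
      have "?M * 1 \<le> ?M * (n + 1) ^ Suc d"
        by (intro mult_le_mono2 one_le_power) simp
      then show "?K + (?M + n * ?K) \<le> (?M + 2 * C) * (n + 1) ^ Suc d"
        by (simp add: algebra_simps)
    qed auto
  qed
  then show ?thesis unfolding poly_covered_def by blast
qed

lemma middle_orbits_expand:
  assumes "\<And>i. i < n \<Longrightarrow> (F ^^ i) x \<in> {\<alpha>..1-\<beta>}" "\<And>i. i < n \<Longrightarrow> (F ^^ i) y \<in> {\<alpha>..1-\<beta>}"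
  shows "\<bar>(F ^^ n) x - (F ^^ n) y\<bar> = \<kappa> ^ n * \<bar>x - y\<bar>"
  using assms
proof (induction n)
  case (Suc n)
  then show ?case
    using middle_expand[of "(F ^^ n) x" "(F ^^ n) y"] by (simp add: mult.assoc)
qed simp

text \<open>The two sides are exchanged at each step, so the points are never on the same one, and
  the gap between the sides is \<open>1 - \<alpha> - \<beta> \<ge> 1/3\<close>.\<close>

lemma opposite_sides:
  assumes "s \<in> {0..1}" "t \<in> {0..1}"
  shows "1/3 \<le> \<bar>(F ^^ n) (\<alpha> * s) - (F ^^ n) (1 - \<beta> + \<beta> * t)\<bar>"
proof (cases "even n")
  case True
  then have n: "n = 2 * (n div 2)" by simp
  show ?thesis
    using left_mem[OF g_iter_unit[OF assms(1)], of "n div 2"]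
      right_mem[OF g_iter_unit[OF assms(2)], of "n div 2"] scales
    by (subst (1 2) n, unfold left_even[OF assms(1)] right_even[OF assms(2)] atLeastAtMost_iff)
      linarith
next
  case False
  then have n: "n = 2 * (n div 2) + 1" by simp
  show ?thesis
    using right_mem[OF g_iter_unit[OF assms(1)], of "n div 2"]
      left_mem[OF g_iter_unit[OF assms(2)], of "Suc (n div 2)"] scales
    by (subst (1 2) n, unfold left_odd[OF assms(1)] right_odd[OF assms(2)] atLeastAtMost_iff)
      linarith
qed

text \<open>Good points are those whose orbit meets the rescaled copy of \<open>R\<close> in the
  left interval. Once both orbits have done so, they are either always on the same side, where
  distances are rescaled distances of \<open>g\<close>, or always on opposite sides. Expansion in
  the middle keeps the exceptional set countable.\<close>

lemma tame_step:
  assumes "tame g (3 * \<epsilon>)"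
  shows "tame F \<epsilon>"
proof -
  obtain R where "R \<subseteq> {0..1} \<and> countable ({0..1} - R) \<and> (\<forall>u\<in>R. g u \<in> R) \<and>
      (\<forall>u\<in>R. \<forall>v\<in>R. settled g (3 * \<epsilon>) u v)"
    using assms unfolding tame_def by (rule exE)
  then have R: "R \<subseteq> {0..1}" "countable ({0..1} - R)" "\<And>u. u \<in> R \<Longrightarrow> g u \<in> R"
    and pairs: "\<And>u v. u \<in> R \<Longrightarrow> v \<in> R \<Longrightarrow> settled g (3 * \<epsilon>) u v"
    by simp_all
  have R_iter: "(g ^^ n) t \<in> R" if "t \<in> R" for n t
    using that R(3) by (induction n) simp_all
  define R' where "R' = {u \<in> {0..1}. \<exists>j. \<exists>t\<in>R. (F ^^ j) u = \<alpha> * t}"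
  have R'_back: "u \<in> R'" if "u \<in> {0..1}" "(F ^^ j) u \<in> R'" for u j
  proof -
    obtain i t where "t \<in> R" "(F ^^ i) ((F ^^ j) u) = \<alpha> * t"
      using \<open>(F ^^ j) u \<in> R'\<close> unfolding R'_def by blast
    then show ?thesis
      using that(1) unfolding R'_def by (metis (mono_tags, lifting) comp_apply funpow_add mem_Collect_eq)
  qed
  have R'_fwd: "F u \<in> R'" if "u \<in> R'" for u
  proof -
    obtain j t where u: "u \<in> {0..1}" and t: "t \<in> R" and j: "(F ^^ j) u = \<alpha> * t"
      using \<open>u \<in> R'\<close> unfolding R'_def by blast
    have "(F ^^ Suc j) (F u) = F (F ((F ^^ j) u))"
      by (simp add: funpow_swap1)
    also have "\<dots> = \<alpha> * g t"
      using t R(1) by (simp add: j F_left F_right subset_iff)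
    finally show ?thesis
      using u t R(3) F_unit unfolding R'_def by blast
  qed
  have left_in: "\<alpha> * t \<in> R'" if "t \<in> R" for t
  proof -
    have "(F ^^ 0) (\<alpha> * t) = \<alpha> * t" by simp
    then show ?thesis
      using that R(1) left_unit unfolding R'_def by blast
  qed
  have right_in: "1 - \<beta> + \<beta> * t \<in> R'" if "t \<in> R" for t
  proof -
    have "(F ^^ 1) (1 - \<beta> + \<beta> * t) \<in> R'"
      using that R left_in by (simp add: F_right subset_iff)
    then show ?thesis
      using R'_back right_unit that R(1) by blast
  qed
  \<comment> \<open>The exceptional points of \<open>g\<close> placed in both sides; an orbit
    avoiding \<open>R'\<close> can leave the middle only into \<open>Q\<close>.\<close>
  define Q where "Q = (\<lambda>t. \<alpha> * t) ` ({0..1} - R) \<union> (\<lambda>t. 1 - \<beta> + \<beta> * t) ` ({0..1} - R)"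
  define M where "M n = {u \<in> {0..1}. \<forall>i<n. (F ^^ i) u \<in> {\<alpha>..1-\<beta>}}" for n
  have outside: "u \<in> Q" if "u \<in> {0..1}" "u \<notin> {\<alpha>..1-\<beta>}" "u \<notin> R'" for u
    using that(1)
  proof (cases u rule: unit_cases)
    case (left t)
    then show ?thesis using left_in[of t] that(3) unfolding Q_def by blast
  next
    case (right t)
    then show ?thesis using right_in[of t] that(3) unfolding Q_def by blast
  qed (use that in simp)
  \<comment> \<open>Two distinct points staying in the middle forever would be driven more than 1
    apart by the factor \<open>\<kappa> ^ n\<close>, so there is at most one.\<close>
  have "countable (\<Inter>n. M n)"
  proof -
    have "u = v" if "u \<in> (\<Inter>n. M n)" "v \<in> (\<Inter>n. M n)" for u v
    proof (rule ccontr)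
      assume "u \<noteq> v"
      then obtain n where n: "1 / \<bar>u - v\<bar> < \<kappa> ^ n"
        using real_arch_pow[OF expanding] by blast
      have "\<kappa> ^ n * \<bar>u - v\<bar> = \<bar>(F ^^ n) u - (F ^^ n) v\<bar>"
        using that by (intro middle_orbits_expand[symmetric]) (auto simp: M_def)
      also have "\<dots> \<le> 1"
        using that F_iter_unit[of u n] F_iter_unit[of v n] by (auto simp: M_def abs_le_iff)
      finally show False
        using n \<open>u \<noteq> v\<close> by (simp add: field_simps)
    qed
    then have "(\<Inter>n. M n) = {} \<or> (\<exists>u. (\<Inter>n. M n) = {u})" by blast
    then show ?thesis by auto
  qed
  \<comment> \<open>\<open>F ^^ n\<close> is injective on the points that spend the first
    \<open>n\<close> times in the middle, so preimages of the countable \<open>Q\<close> stay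
    countable.\<close>
  moreover have "countable {u \<in> M n. (F ^^ n) u \<in> Q}" for n
  proof (rule countable_image_inj_on[where f = "F ^^ n"])
    have "countable Q"
      using R(2) unfolding Q_def by simp
    then show "countable ((F ^^ n) ` {u \<in> M n. (F ^^ n) u \<in> Q})"
      by (rule countable_subset[rotated]) blast
    show "inj_on (F ^^ n) {u \<in> M n. (F ^^ n) u \<in> Q}"
    proof (rule inj_onI)
      fix u v
      assume "u \<in> {u \<in> M n. (F ^^ n) u \<in> Q}" "v \<in> {u \<in> M n. (F ^^ n) u \<in> Q}"
        "(F ^^ n) u = (F ^^ n) v"
      then show "u = v"
        using middle_orbits_expand[of n u v] expanding by (simp add: M_def)
    qed
  qed
  moreover have "{0..1} - R' \<subseteq> (\<Inter>n. M n) \<union> (\<Union>n. {u \<in> M n. (F ^^ n) u \<in> Q})"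
  proof
    fix u assume u: "u \<in> {0..1} - R'"
    show "u \<in> (\<Inter>n. M n) \<union> (\<Union>n. {u \<in> M n. (F ^^ n) u \<in> Q})"
    proof (cases "\<exists>n. (F ^^ n) u \<notin> {\<alpha>..1-\<beta>}")
      case True
      define n where "n = (LEAST n. (F ^^ n) u \<notin> {\<alpha>..1-\<beta>})"
      have "(F ^^ n) u \<notin> {\<alpha>..1-\<beta>}"
        unfolding n_def using True by (rule LeastI_ex)
      moreover have "(F ^^ i) u \<in> {\<alpha>..1-\<beta>}" if "i < n" for i
        using not_less_Least[OF that[unfolded n_def]] by blast
      moreover have "(F ^^ n) u \<notin> R'"
        using u R'_back by blast
      ultimately have "u \<in> M n" "(F ^^ n) u \<in> Q"
        using u outside[OF F_iter_unit] unfolding M_def by blast+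
      then show ?thesis by blast
    next
      case False
      then show ?thesis using u unfolding M_def by blast
    qed
  qed
  ultimately have count: "countable ({0..1} - R')"
    by (meson countable_Un countable_UN countableI_type countable_subset)
  \<comment> \<open>The parity of \<open>k - j\<close> decides whether the two orbits are on the
    same side at time \<open>k\<close>; the case \<open>j \<le> k\<close> suffices by
    symmetry.\<close>
  have "settled F \<epsilon> u v"
    if s: "s \<in> R" "(F ^^ j) u = \<alpha> * s" and t: "t \<in> R" "(F ^^ k) v = \<alpha> * t" and "j \<le> k"
    for u v j k s t
  proof (cases "even (k - j)")
    case True
    then obtain r where "k - j = 2 * r" by (rule evenE)
    then have r: "k = 2 * r + j" using \<open>j \<le> k\<close> by simp
    define s' where "s' = (g ^^ r) s"
    have s'R: "s' \<in> R" using R_iter s(1) by (simp add: s'_def)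
    have unit: "s \<in> {0..1}" "s' \<in> {0..1}" "t \<in> {0..1}"
      using s(1) s'R t(1) R(1) by blast+
    have u_k: "(F ^^ k) u = \<alpha> * s'"
      unfolding r funpow_add comp_apply s(2) s'_def by (rule left_even[OF unit(1)])
    have even: "\<bar>(F ^^ (2 * n + k)) u - (F ^^ (2 * n + k)) v\<bar> = \<alpha> * \<bar>(g ^^ n) s' - (g ^^ n) t\<bar>"
      for n
      unfolding funpow_add comp_apply u_k t(2) left_even[OF unit(2)] left_even[OF unit(3)]
      by (rule scaled_dist)
    have odd: "\<bar>(F ^^ (2 * n + 1 + k)) u - (F ^^ (2 * n + 1 + k)) v\<bar> = \<beta> * \<bar>(g ^^ n) s' - (g ^^ n) t\<bar>"
      for n
      unfolding funpow_add[of "2 * n + 1"] comp_apply u_k t(2) left_odd[OF unit(2)] left_odd[OF unit(3)]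
      by (rule scaled_dist)
    \<comment> \<open>Even and odd times after \<open>k\<close> carry the factors \<alpha> and
      \<beta>, so what eventually holds for both rescaled distances eventually holds along
      \<open>F\<close>.\<close>
    have transfer: "\<forall>\<^sub>F n in sequentially. P \<bar>(F ^^ n) u - (F ^^ n) v\<bar>"
      if ev: "\<forall>\<^sub>F n in sequentially. P (\<alpha> * \<bar>(g ^^ n) s' - (g ^^ n) t\<bar>) \<and> P (\<beta> * \<bar>(g ^^ n) s' - (g ^^ n) t\<bar>)"
      for P
    proof -
      obtain N where N: "\<forall>n\<ge>N.
          P (\<alpha> * \<bar>(g ^^ n) s' - (g ^^ n) t\<bar>) \<and> P (\<beta> * \<bar>(g ^^ n) s' - (g ^^ n) t\<bar>)"
        using ev unfolding eventually_sequentially by (rule exE)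
      have "P \<bar>(F ^^ n) u - (F ^^ n) v\<bar>" if "n \<ge> 2 * N + k" for n
      proof (cases "even (n - k)")
        case True
        then have n: "n = 2 * ((n - k) div 2) + k" using that by simp
        have "N \<le> (n - k) div 2" using that by linarith
        then show ?thesis
          using N[rule_format, of "(n - k) div 2"] even[of "(n - k) div 2", folded n] by simp
      next
        case False
        then have n: "n = 2 * ((n - k) div 2) + 1 + k"
          using odd_two_times_div_two_succ[OF False] that by linarith
        have "N \<le> (n - k) div 2" using that by linarith
        then show ?thesis
          using N[rule_format, of "(n - k) div 2"] odd[of "(n - k) div 2", folded n] by simp
      qed
      then show ?thesis
        unfolding eventually_sequentially by (intro exI[of _ "2 * N + k"] allI impI)
    qed
    show ?thesis
      using pairs[OF s'R t(1), unfolded settled_def]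
    proof
      assume "\<forall>\<^sub>F n in sequentially. \<bar>(g ^^ n) s' - (g ^^ n) t\<bar> \<le> 3 * \<epsilon>"
      then have "\<forall>\<^sub>F n in sequentially. \<bar>(F ^^ n) u - (F ^^ n) v\<bar> \<le> \<epsilon>"
        by (intro transfer) (erule eventually_mono, simp add: contract_left)
      then show ?thesis unfolding settled_def ..
    next
      assume "\<exists>\<delta>>0. \<forall>\<^sub>F n in sequentially. \<delta> \<le> \<bar>(g ^^ n) s' - (g ^^ n) t\<bar>"
      then obtain \<delta> where \<delta>: "\<delta> > 0" "\<forall>\<^sub>F n in sequentially. \<delta> \<le> \<bar>(g ^^ n) s' - (g ^^ n) t\<bar>"
        by blast
      \<comment> \<open>The smaller factor \<beta> gives a lower bound valid at both
        parities.\<close>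
      from \<delta>(2) have "\<forall>\<^sub>F n in sequentially. \<beta> * \<delta> \<le> \<alpha> * \<bar>(g ^^ n) s' - (g ^^ n) t\<bar> \<and>
          \<beta> * \<delta> \<le> \<beta> * \<bar>(g ^^ n) s' - (g ^^ n) t\<bar>"
      proof eventually_elim
        case (elim n)
        show ?case
          using mult_mono[OF scales(2) elim] mult_left_mono[OF elim, of \<beta>] scales \<delta>(1) by simp
      qed
      then have "\<forall>\<^sub>F n in sequentially. \<beta> * \<delta> \<le> \<bar>(F ^^ n) u - (F ^^ n) v\<bar>"
        by (rule transfer)
      then show ?thesis
        unfolding settled_def using mult_pos_pos[OF scales(1) \<delta>(1)] by (intro disjI2 exI conjI)
    qed
  next
    case False
    then obtain r where "k - j = 2 * r + 1" by (rule oddE)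
    then have r: "k = 2 * r + 1 + j" using \<open>j \<le> k\<close> by simp
    define s' where "s' = (g ^^ r) s"
    have unit: "s \<in> {0..1}" "s' \<in> {0..1}" "t \<in> {0..1}"
      using s(1) R_iter[OF s(1)] t(1) R(1) unfolding s'_def by blast+
    have u_k: "(F ^^ k) u = 1 - \<beta> + \<beta> * s'"
      unfolding r funpow_add[of "2 * r + 1"] comp_apply s(2) s'_def by (rule left_odd[OF unit(1)])
    have *: "1/3 \<le> \<bar>(F ^^ (n + k)) u - (F ^^ (n + k)) v\<bar>" for n
      unfolding funpow_add comp_apply u_k t(2)
      using opposite_sides[OF unit(3,2), of n] by (simp add: abs_minus_commute)
    have "1/3 \<le> \<bar>(F ^^ n) u - (F ^^ n) v\<bar>" if "n \<ge> k" for n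
      using that *[of "n - k"] by simp
    then have "\<forall>\<^sub>F n in sequentially. 1/3 \<le> \<bar>(F ^^ n) u - (F ^^ n) v\<bar>"
      unfolding eventually_sequentially by (intro exI[of _ k] allI impI)
    then show ?thesis
      unfolding settled_def by (intro disjI2 exI[of _ "1/3"]) simp
  qed
  note key = this
  have "settled F \<epsilon> u v"
    if uv: "u \<in> R'" "v \<in> R'" for u v
  proof -
    obtain j s where s: "s \<in> R" "(F ^^ j) u = \<alpha> * s"
      using uv(1) unfolding R'_def by blast
    obtain k t where t: "t \<in> R" "(F ^^ k) v = \<alpha> * t"
      using uv(2) unfolding R'_def by blast
    show ?thesis
      using key[OF s t] key[OF t s] settled_sym[of F \<epsilon> u v] by (cases "j \<le> k") simp_all
  qed
  moreover have "R' \<subseteq> {0..1}"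
    unfolding R'_def by blast
  ultimately show ?thesis
    unfolding tame_def using count R'_fwd by (intro exI[of _ R'] conjI ballI)
qed

end

text \<open>The parity of the time determines the side, so coinciding iterates have times of equal
  parity; cancelling the rescaling leaves iterates of \<open>g\<close> at the halved times.\<close>

lemma (in renormalization) disjoint_orbit_step:
  assumes inj: "\<And>i j s t. \<lbrakk>i < p; j < p; s \<in> U; t \<in> U; (g ^^ i) s = (g ^^ j) t\<rbrakk> \<Longrightarrow> i = j"
    and U: "U \<subseteq> {0..1}" "s \<in> U" "t \<in> U" and ij: "i < 2 * p" "j < 2 * p"
    and eq: "(F ^^ i) (\<alpha> * s) = (F ^^ j) (\<alpha> * t)"
  shows "i = j"
proof -
  have st: "s \<in> {0..1}" "t \<in> {0..1}" using U by blast+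
  have half: "i div 2 < p" "j div 2 < p" using ij by auto
  have apart: "(F ^^ i') (\<alpha> * s') \<noteq> (F ^^ j') (\<alpha> * t')"
    if "even i'" "odd j'" "s' \<in> {0..1}" "t' \<in> {0..1}" for i' j' s' t'
  proof -
    have "i' = 2 * (i' div 2)" "j' = 2 * (j' div 2) + 1" using that by simp_all
    then have "(F ^^ i') (\<alpha> * s') = \<alpha> * (g ^^ (i' div 2)) s'"
      "(F ^^ j') (\<alpha> * t') = 1 - \<beta> + \<beta> * (g ^^ (j' div 2)) t'"
      using left_even[OF that(3), of "i' div 2"] left_odd[OF that(4), of "j' div 2"] by simp_all
    moreover have "\<alpha> < 1 - \<beta>" using scales by linarith
    ultimately show ?thesis
      using left_mem[OF g_iter_unit[OF that(3), of "i' div 2"]]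
        right_mem[OF g_iter_unit[OF that(4), of "j' div 2"]] by auto
  qed
  consider "even i" "even j" | "odd i" "odd j" | "even i" "odd j" | "odd i" "even j" by blast
  then show ?thesis
  proof cases
    case 1
    then have "i = 2 * (i div 2)" "j = 2 * (j div 2)" by simp_all
    then have "\<alpha> * (g ^^ (i div 2)) s = \<alpha> * (g ^^ (j div 2)) t"
      using eq left_even[OF st(1), of "i div 2"] left_even[OF st(2), of "j div 2"] by simp
    then have "i div 2 = j div 2"
      using inj[OF half U(2,3)] scales by simp
    then show ?thesis using 1 by presburger
  next
    case 2
    then have "i = 2 * (i div 2) + 1" "j = 2 * (j div 2) + 1" by simp_all
    then have "\<beta> * (g ^^ (i div 2)) s = \<beta> * (g ^^ (j div 2)) t"
      using eq left_odd[OF st(1), of "i div 2"] left_odd[OF st(2), of "j div 2"] by simp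
    then have "i div 2 = j div 2"
      using inj[OF half U(2,3)] scales by simp
    then show ?thesis using 2 by presburger
  qed (use apart st eq in metis)+
qed

section \<open>Zero entropy and absence of Li-Yorke chaos for the two maps\<close>

interpretation delahaye: renormalization delahaye delahaye "1/3" "1/3" "7/3"
proof
  show "delahaye x \<in> {0..1}" if "x \<in> {0..1}" for x
    using that by (rule delahaye_in_unit)
  show "delahaye (1/3 * t) = 1 - 1/3 + 1/3 * t" if "t \<in> {0..1}" for t
    using that by (subst delahaye_left) auto
  show "delahaye (1 - 1/3 + 1/3 * t) = 1/3 * delahaye t" if "t \<in> {0..1}" for t
    using that by (subst delahaye_right) auto
  show "delahaye x - delahaye y = 7/3 * (y - x)" if "x \<in> {1/3..1-1/3}" "y \<in> {1/3..1-1/3}" for x y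
    using that by (simp add: delahaye_middle algebra_simps)
qed auto

interpretation solenoid: renormalization solenoid_map delahaye "1/3" "1/9" "7/5"
proof
  show "delahaye x \<in> {0..1}" if "x \<in> {0..1}" for x
    using that by (rule delahaye_in_unit)
  show "solenoid_map (1/3 * t) = 1 - 1/9 + 1/9 * t" if "t \<in> {0..1}" for t
    using that by (simp add: solenoid_map_def)
  show "solenoid_map (1 - 1/9 + 1/9 * t) = 1/3 * delahaye t" if "t \<in> {0..1}" for t
    using that delahaye_nonpos[of 0] by (auto simp: solenoid_map_def)
  show "solenoid_map x - solenoid_map y = 7/5 * (y - x)"
    if "x \<in> {1/3..1-1/9}" "y \<in> {1/3..1-1/9}" for x y
    using that by (auto simp: solenoid_map_def algebra_simps)
qed auto

lemma poly_covered_mono: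
  assumes "poly_covered F \<epsilon>" "\<epsilon> \<le> \<epsilon>'"
  shows "poly_covered F \<epsilon>'"
proof -
  have "covered F n \<epsilon>' S K" if "covered F n \<epsilon> S K" for n S K
    using that by (rule covered_pullback[where h = "\<lambda>x. x"]) (use assms(2) in \<open>auto intro: order_trans\<close>)
  then show ?thesis
    using assms(1) unfolding poly_covered_def by blast
qed

lemma unit_dist: "x \<in> {0..1} \<Longrightarrow> y \<in> {0..1} \<Longrightarrow> \<bar>x - y\<bar> \<le> (1::real)"
  by auto

text \<open>Delahaye's map renormalizes to itself, so the step from \<open>3 * \<epsilon>\<close> to
  \<epsilon> can be iterated from the trivial scale 1.\<close>

lemma poly_covered_delahaye: "poly_covered delahaye ((1/3) ^ k)"
proof (induction k)
  case 0
  have "\<bar>(delahaye ^^ i) x - (delahaye ^^ i) y\<bar> \<le> 1" if "x \<in> {0..1}" "y \<in> {0..1}" for i x y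
    by (intro unit_dist delahaye.F_iter_unit that)
  then have "covered delahaye n 1 {0..1} (1 * (n + 1) ^ 0)" for n
    unfolding covered_def by (intro exI[of _ "\<lambda>_. 0"]) (simp del: atLeastAtMost_iff)
  then show ?case
    unfolding poly_covered_def power_0 by (intro exI[of _ 1] exI[of _ 0]) simp
next
  case (Suc k)
  then show ?case using delahaye.poly_covered_step[of "(1/3) ^ Suc k"] by simp
qed

lemma solenoid_entropy: "topological_entropy {0..1} solenoid_map = 0"
proof (rule topological_entropy_eq_0)
  fix \<epsilon> :: real assume "\<epsilon> > 0"
  then have "\<exists>k. (1/3) ^ k < 3 * \<epsilon>"
    by (intro real_arch_pow_inv) simp_all
  then obtain k where "(1/3) ^ k < 3 * \<epsilon>" by (rule exE)
  then have "poly_covered delahaye (3 * \<epsilon>)"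
    by (intro poly_covered_mono[OF poly_covered_delahaye less_imp_le])
  then show "poly_covered solenoid_map \<epsilon>"
    using \<open>\<epsilon> > 0\<close> by (rule solenoid.poly_covered_step)
qed

lemma tame_delahaye: "tame delahaye ((1/3) ^ k)"
proof (induction k)
  case 0
  have "settled delahaye 1 u v" if "u \<in> {0..1}" "v \<in> {0..1}" for u v
    unfolding settled_def
    by (intro disjI1 always_eventually allI unit_dist delahaye.F_iter_unit that)
  then show ?case
    unfolding tame_def using delahaye_in_unit
    by (intro exI[of _ "{0..1}"]) (simp del: atLeastAtMost_iff)
next
  case (Suc k)
  then show ?case using delahaye.tame_step[of "(1/3) ^ Suc k"] by simp
qed

lemma solenoid_not_chaotic: "\<not> Li_Yorke_chaotic {0..1} solenoid_map"
proof (rule not_Li_Yorke_chaotic)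
  show "tame solenoid_map ((1/3) ^ Suc k)" for k
    using tame_delahaye[of k] solenoid.tame_step[of "(1/3) ^ Suc k"] by simp
  show "(\<lambda>k. (1/3::real) ^ Suc k) \<longlonglongrightarrow> 0"
    by (intro LIMSEQ_Suc LIMSEQ_realpow_zero) auto
qed

section \<open>Solenoidal structure of the limit set\<close>

lemma scaled_interval: "(c::real) > 0 \<Longrightarrow> (\<lambda>s. c * s) ` {0..1} = {0..c}"
  by (simp add: image_mult_atLeastAtMost)

lemma delahaye_renorm:
  "s \<in> {0..1} \<Longrightarrow> (delahaye ^^ (2^t)) ((1/3)^t * s) = (1/3)^t * delahaye s"
proof (induction t)
  case (Suc t)
  have "(1/3)^t * s \<in> {0..1}"
    using Suc.prems by (auto intro!: mult_le_one power_le_one)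
  from delahaye.left_even[OF this, of "2^t"] show ?case
    using Suc by simp
qed simp

lemma solenoid_renorm:
  assumes "s \<in> {0..1}"
  shows "(solenoid_map ^^ (2^Suc t)) ((1/3)^Suc t * s) = (1/3)^Suc t * delahaye s"
proof -
  have "(1/3)^t * s \<in> {0..1}"
    using assms by (auto intro!: mult_le_one power_le_one)
  from solenoid.left_even[OF this, of "2^t"] show ?thesis
    using delahaye_renorm[OF assms, of t] by simp
qed

lemma delahaye_disjoint:
  "\<lbrakk>i < 2^t; j < 2^t; x \<in> {0..(1/3)^t}; y \<in> {0..(1/3)^t}; (delahaye ^^ i) x = (delahaye ^^ j) y\<rbrakk>
    \<Longrightarrow> i = j"
proof (induction t arbitrary: i j x y)
  case (Suc t)
  show ?case
  proof (rule delahaye.disjoint_orbit_step[of "2^t" "{0..(1/3)^t}" "3 * x" "3 * y"])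
    show "{0..(1/3)^t} \<subseteq> {0..1::real}"
      using power_le_one[of "1/3::real" t] by fastforce
    show "i' = j'" if "i' < 2^t" "j' < 2^t" "s \<in> {0..(1/3)^t}" "u \<in> {0..(1/3)^t}"
      "(delahaye ^^ i') s = (delahaye ^^ j') u" for i' j' s u
      using that by (rule Suc.IH)
    show "3 * x \<in> {0..(1/3)^t}" "3 * y \<in> {0..(1/3)^t}"
      using Suc.prems(3,4) by simp_all
    show "(delahaye ^^ i) (1/3 * (3 * x)) = (delahaye ^^ j) (1/3 * (3 * y))"
      using Suc.prems(5) by simp
    show "i < 2 * 2^t" "j < 2 * 2^t"
      using Suc.prems(1,2) by simp_all
  qed
qed simp

text \<open>The iterate acts on the interval as a rescaled Delahaye map, whose surjectivity on the
  unit interval gives invariance. Disjointness of the images is one more doubling step after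
  \<open>delahaye_disjoint\<close>.\<close>

lemma solenoid_periodic: "periodic_set solenoid_map (2^Suc t) {0..(1/3)^Suc t}"
proof -
  let ?c = "(1/3)^Suc t :: real"
  have "(solenoid_map ^^ (2^Suc t)) ` {0..?c} = (\<lambda>s. (solenoid_map ^^ (2^Suc t)) (?c * s)) ` {0..1}"
    by (subst scaled_interval[symmetric]) (simp_all add: image_image)
  also have "\<dots> = (\<lambda>s. ?c * delahaye s) ` {0..1}"
    by (intro image_cong refl solenoid_renorm)
  also have "\<dots> = (\<lambda>s. ?c * s) ` (delahaye ` {0..1})"
    by (simp only: image_image)
  also have "\<dots> = {0..?c}"
    unfolding delahaye_surj by (rule scaled_interval) simp
  finally have image: "(solenoid_map ^^ (2^Suc t)) ` {0..?c} = {0..?c}" .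
  have "i = j" if "i < 2^Suc t" "j < 2^Suc t" "x \<in> {0..?c}" "y \<in> {0..?c}"
    "(solenoid_map ^^ i) x = (solenoid_map ^^ j) y" for i j x y
  proof (rule solenoid.disjoint_orbit_step[of "2^t" "{0..(1/3)^t}" "3 * x" "3 * y"])
    show "{0..(1/3)^t} \<subseteq> {0..1::real}"
      using power_le_one[of "1/3::real" t] by fastforce
    show "i' = j'" if "i' < 2^t" "j' < 2^t" "s \<in> {0..(1/3)^t}" "u \<in> {0..(1/3)^t}"
      "(delahaye ^^ i') s = (delahaye ^^ j') u" for i' j' s u
      using that by (rule delahaye_disjoint)
    show "3 * x \<in> {0..(1/3)^t}" "3 * y \<in> {0..(1/3)^t}"
      using that(3,4) by simp_all
    show "(solenoid_map ^^ i) (1/3 * (3 * x)) = (solenoid_map ^^ j) (1/3 * (3 * y))"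
      using that(5) by simp
    show "i < 2 * 2^t" "j < 2 * 2^t"
      using that(1,2) by simp_all
  qed
  then have "disjoint_family_on (\<lambda>k. (solenoid_map ^^ k) ` {0..?c}) {..<2^Suc t}"
    unfolding disjoint_family_on_def by blast
  with image show ?thesis
    unfolding periodic_set_def by simp
qed

lemma continuous_on_funpow:
  fixes f :: "'a::topological_space \<Rightarrow> 'a"
  assumes "continuous_on UNIV f"
  shows "continuous_on S (f ^^ n)"
proof -
  have "continuous_on UNIV (f ^^ n)"
    by (induction n) (auto intro: continuous_on_compose2[OF assms] continuous_on_id)
  then show ?thesis using continuous_on_subset by blast
qed

text \<open>The orbit runs through finitely many compact images of \<open>J\<close>; their union is
  closed and so contains all limit points.\<close>

lemma omega_limit_subset_periodic:
  fixes f :: "'a::t2_space \<Rightarrow> 'a"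
  assumes "continuous_on UNIV f" "compact J" "periodic_set f p J" "x \<in> J"
  shows "omega_limit_set f x \<subseteq> (\<Union>i<p. (f ^^ i) ` J)"
proof
  fix y assume "y \<in> omega_limit_set f x"
  then obtain r where r: "(\<lambda>n. (f ^^ r n) x) \<longlonglongrightarrow> y"
    unfolding omega_limit_set_def by blast
  have p: "p > 0" "(f ^^ p) ` J = J"
    using assms(3) unfolding periodic_set_def by auto
  have "((f ^^ p) ^^ q) x \<in> J" for q
    using assms(4) p(2) by (induction q) auto
  then have "(f ^^ (n mod p)) ((f ^^ (p * (n div p))) x) \<in> (f ^^ (n mod p)) ` J" for n
    unfolding funpow_mult by (rule imageI)
  moreover have "(f ^^ (n mod p)) ((f ^^ (p * (n div p))) x) = (f ^^ n) x" for n
    by (metis comp_apply funpow_add mod_mult_div_eq)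
  ultimately have orbit: "(f ^^ n) x \<in> (\<Union>i<p. (f ^^ i) ` J)" for n
    using p(1) by (metis UN_iff lessThan_iff mod_less_divisor)
  have "closed (\<Union>i<p. (f ^^ i) ` J)"
    by (intro compact_imp_closed compact_UN compact_continuous_image
        continuous_on_funpow assms) auto
  then show "y \<in> (\<Union>i<p. (f ^^ i) ` J)"
    using orbit r by (rule Lim_in_closed_set[OF _ always_eventually[OF allI] sequentially_bot])
qed

lemma solenoid_solenoidal: "solenoidal {0..1} solenoid_map (omega_limit_set solenoid_map 0)"
  unfolding solenoidal_def
proof (intro exI conjI allI)
  let ?p = "\<lambda>t. 2^Suc t :: nat"
  let ?b = "\<lambda>t. (1/3)^Suc t :: real"
  show "2 \<le> ?p 0" by simp
  show "strict_mono ?p" by (auto simp: strict_mono_def)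
  fix t
  show "(0::real) < ?b t" by simp
  show "{0..?b t} \<subseteq> {0..1}"
    using power_le_one[of "1/3::real" "Suc t"] by auto
  show "{0..?b (Suc t)} \<subseteq> {0..?b t}" by auto
  show "periodic_set solenoid_map (?p t) {0..?b t}" by (rule solenoid_periodic)
next
  show "omega_limit_set solenoid_map 0 \<subseteq>
      (\<Inter>t. \<Union>i<2^Suc t. (solenoid_map ^^ i) ` {0..(1/3)^Suc t})"
    by (intro INT_greatest omega_limit_subset_periodic solenoid_periodic solenoid_map_continuous) auto
qed

section \<open>Recurrence along the orbit of 0\<close>

text \<open>The base-3 image of the van der Corput sequence: binary digits of \<open>n\<close>, starting from the lowest,
  become the ternary digits \<open>0\<close> and \<open>2\<close> of \<open>vdc n\<close>.\<close>

definition vdc :: "nat \<Rightarrow> real" where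
  "vdc n = (delahaye ^^ n) 0"

definition orbit :: "nat \<Rightarrow> real" where
  "orbit n = (solenoid_map ^^ n) 0"

lemma vdc_unit: "vdc n \<in> {0..1}"
  unfolding vdc_def by (rule delahaye.F_iter_unit) simp

lemma vdc_even: "even n \<Longrightarrow> vdc n = vdc (n div 2) / 3"
  using delahaye.left_even[of 0 "n div 2"] by (simp add: vdc_def)

lemma vdc_odd: "odd n \<Longrightarrow> vdc n = 2/3 + vdc (n div 2) / 3"
  using delahaye.left_odd[of 0 "n div 2"] by (simp add: vdc_def)

lemma orbit_even: "even n \<Longrightarrow> orbit n = vdc (n div 2) / 3"
  using solenoid.left_even[of 0 "n div 2"] by (simp add: vdc_def orbit_def)

lemma orbit_odd: "odd n \<Longrightarrow> orbit n = 8/9 + vdc (n div 2) / 9"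
  using solenoid.left_odd[of 0 "n div 2"] by (simp add: vdc_def orbit_def)

text \<open>The strict inequality makes the gap between even and odd times exceed 1/3, as
  \<open>vdc_apart\<close> requires.\<close>

lemma vdc_less_1: "vdc n < 1"
proof (induction n rule: less_induct)
  case (less n)
  show ?case
  proof (cases "even n")
    case True
    then show ?thesis using vdc_even[OF True] vdc_unit[of "n div 2"] by simp
  next
    case False
    then have "n div 2 < n" by presburger
    then show ?thesis using vdc_odd[OF False] less by fastforce
  qed
qed

lemma mod_2_power_Suc:
  "i mod 2 ^ Suc k = j mod 2 ^ Suc k \<longleftrightarrow>
    (even i \<longleftrightarrow> even j) \<and> i div 2 mod 2 ^ k = j div 2 mod 2 ^ k" for i j :: nat
proof -
  have *: "n mod 2 ^ Suc k = 2 * (n div 2 mod 2 ^ k) + n mod 2" for n :: nat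
    using mod_mult2_eq[of n 2 "2 ^ k"] by simp
  have "2 * a + i mod 2 = 2 * b + j mod 2 \<longleftrightarrow> (even i \<longleftrightarrow> even j) \<and> a = b" for a b :: nat
    by presburger
  then show ?thesis
    unfolding * .
qed

lemma abs_diff_affine:
  fixes a b :: real
  assumes "a = d + x / c" "b = d + y / c" "c > 0"
  shows "\<bar>a - b\<bar> = \<bar>x - y\<bar> / c"
  using assms by (simp add: abs_divide flip: diff_divide_distrib)

lemma vdc_dist:
  assumes "even i \<longleftrightarrow> even j"
  shows "\<bar>vdc i - vdc j\<bar> = \<bar>vdc (i div 2) - vdc (j div 2)\<bar> / 3"
proof (cases "even i")
  case True
  then show ?thesis
    using assms by (intro abs_diff_affine[where d = 0]) (simp_all add: vdc_even)
next
  case False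
  then show ?thesis
    using assms by (intro abs_diff_affine[where d = "2/3"]) (simp_all add: vdc_odd)
qed

lemma vdc_close: "i mod 2 ^ k = j mod 2 ^ k \<Longrightarrow> \<bar>vdc i - vdc j\<bar> \<le> (1/3) ^ k"
proof (induction k arbitrary: i j)
  case 0
  then show ?case using unit_dist[OF vdc_unit vdc_unit] by simp
next
  case (Suc k)
  then have par: "even i \<longleftrightarrow> even j" and "\<bar>vdc (i div 2) - vdc (j div 2)\<bar> \<le> (1/3) ^ k"
    unfolding mod_2_power_Suc by blast+
  then show ?case using vdc_dist[OF par] by simp
qed

text \<open>Comparing binary digits from the lowest, each common digit contracts by 3, and the first
  different one leaves a gap above 1/3.\<close>

lemma vdc_apart: "i mod 2 ^ k \<noteq> j mod 2 ^ k \<Longrightarrow> (1/3) ^ k < \<bar>vdc i - vdc j\<bar>"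
proof (induction k arbitrary: i j)
  case (Suc k)
  show ?case
  proof (cases "even i \<longleftrightarrow> even j")
    case True
    then have "(1/3) ^ k < \<bar>vdc (i div 2) - vdc (j div 2)\<bar>"
      using Suc unfolding mod_2_power_Suc by blast
    then show ?thesis using vdc_dist[OF True] by simp
  next
    case False
    have "(1/3 :: real) ^ Suc k \<le> 1/3"
      using power_le_one[of "1/3::real" k] by simp
    also have "1/3 < \<bar>vdc i - vdc j\<bar>"
      using False vdc_even[of i] vdc_even[of j] vdc_odd[of i] vdc_odd[of j]
        vdc_unit[of "i div 2"] vdc_unit[of "j div 2"] vdc_less_1[of "i div 2"] vdc_less_1[of "j div 2"]
      by (cases "even i") auto
    finally show ?thesis .
  qed
qed simp

lemma vdc_dist_le_iff: "\<bar>vdc i - vdc j\<bar> \<le> (1/3) ^ k \<longleftrightarrow> i mod 2 ^ k = j mod 2 ^ k"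
  using vdc_close vdc_apart by (meson not_less)

lemma orbit_dist_even:
  "even i \<Longrightarrow> even j \<Longrightarrow> \<bar>orbit i - orbit j\<bar> = \<bar>vdc (i div 2) - vdc (j div 2)\<bar> / 3"
  by (intro abs_diff_affine[where d = 0]) (simp_all add: orbit_even)

lemma orbit_dist_odd:
  "odd i \<Longrightarrow> odd j \<Longrightarrow> \<bar>orbit i - orbit j\<bar> = \<bar>vdc (i div 2) - vdc (j div 2)\<bar> / 9"
  by (intro abs_diff_affine[where d = "8/9"]) (simp_all add: orbit_odd)

lemmas orbit_dist = orbit_dist_even orbit_dist_odd

lemma orbit_dist_mixed: "even i \<noteq> even j \<Longrightarrow> 1/2 < \<bar>orbit i - orbit j\<bar>"
  using vdc_unit[of "i div 2"] vdc_unit[of "j div 2"]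
  by (cases "even i") (auto simp: orbit_even orbit_odd)

lemma orbit_close:
  assumes "i mod 2 ^ k = j mod 2 ^ k"
  shows "\<bar>orbit i - orbit j\<bar> \<le> (1/3) ^ k"
proof (cases k)
  case 0
  then show ?thesis
    unfolding orbit_def 0 power_0 by (intro unit_dist solenoid.F_iter_unit) simp_all
next
  case (Suc r)
  then have "even i \<longleftrightarrow> even j" "\<bar>vdc (i div 2) - vdc (j div 2)\<bar> \<le> (1/3) ^ r"
    using assms vdc_close unfolding Suc mod_2_power_Suc by blast+
  then show ?thesis
    using orbit_dist[of i j] by (cases "even i") (simp_all add: Suc)
qed

text \<open>Odd times live in a copy of scale 1/9 instead of 1/3, hence the extra factor 1/3 against
  \<open>orbit_close\<close>.\<close>

lemma orbit_apart:
  assumes "i mod 2 ^ k \<noteq> j mod 2 ^ k"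
  shows "(1/3) ^ Suc k \<le> \<bar>orbit i - orbit j\<bar>"
proof (cases k)
  case 0
  then show ?thesis using assms by simp
next
  case (Suc r)
  show ?thesis
  proof (cases "even i \<longleftrightarrow> even j")
    case True
    then have "(1/3) ^ r < \<bar>vdc (i div 2) - vdc (j div 2)\<bar>"
      using assms vdc_apart unfolding Suc mod_2_power_Suc by blast
    then show ?thesis
      using True orbit_dist[of i j] by (cases "even i") (simp_all add: Suc)
  next
    case False
    have "(1/3 :: real) ^ Suc k \<le> 1/3"
      using power_le_one[of "1/3::real" k] by simp
    then show ?thesis using orbit_dist_mixed[OF False] by linarith
  qed
qed

section \<open>Existence of the limits for every \<epsilon>\<close>

definition close_pair :: "real \<Rightarrow> nat \<Rightarrow> nat \<Rightarrow> bool" where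
  "close_pair \<epsilon> i j \<longleftrightarrow> \<bar>orbit i - orbit j\<bar> \<le> \<epsilon>"

lemma corr_sum_eq_density:
  assumes "m > 0"
  shows "corr_sum solenoid_map m 0 n \<epsilon> = pair_density (\<lambda>i j. \<forall>s<m. close_pair \<epsilon> (i + s) (j + s)) n"
proof -
  have "bowen_dist solenoid_map m ((solenoid_map ^^ i) 0) ((solenoid_map ^^ j) 0) \<le> \<epsilon> \<longleftrightarrow>
      (\<forall>s<m. close_pair \<epsilon> (i + s) (j + s))" for i j
    unfolding bowen_dist_def using assms
    by (subst Max_le_iff)
      (auto simp: dist_real_def close_pair_def orbit_def add.commute[of _ "_::nat"] funpow_add)
  then show ?thesis
    by (simp add: corr_sum_def pair_density_def)
qed

text \<open>For a fixed class \<open>a\<close>, an ambiguous class \<open>b\<close> has its point in one of two intervals of length \<open>4\<cdot>3\<^sup>-\<^sup>K\<close>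
  around \<open>orbit a \<plusminus> \<epsilon>\<close>; these points are \<open>3\<^sup>-\<^sup>K\<^sup>-\<^sup>1\<close>-separated, which leaves room for \<open>13\<close> each.\<close>

lemma card_ambiguous_close_pair:
  "card (ambiguous (close_pair \<epsilon>) (2 ^ K)) \<le> 26 * 2 ^ K"
proof -
  let ?h = "(1/3) ^ K :: real"
  define B where "B a = {b. b < 2 ^ K \<and> \<bar>\<bar>orbit a - orbit b\<bar> - \<epsilon>\<bar> \<le> 2 * ?h}" for a
  have "ambiguous (close_pair \<epsilon>) (2 ^ K) \<subseteq> (SIGMA a:{..<2 ^ K}. B a)"
  proof clarify
    fix a b assume "(a, b) \<in> ambiguous (close_pair \<epsilon>) (2 ^ K)"
    then obtain i j i' j' where ab: "a < 2 ^ K" "b < 2 ^ K"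
      and res: "i mod 2 ^ K = a" "i' mod 2 ^ K = a" "j mod 2 ^ K = b" "j' mod 2 ^ K = b"
      and P: "close_pair \<epsilon> i j" "\<not> close_pair \<epsilon> i' j'"
      unfolding ambiguous_def by blast
    have "\<bar>orbit i - orbit a\<bar> \<le> ?h" "\<bar>orbit i' - orbit a\<bar> \<le> ?h"
      "\<bar>orbit j - orbit b\<bar> \<le> ?h" "\<bar>orbit j' - orbit b\<bar> \<le> ?h"
      using res ab by (auto intro!: orbit_close)
    \<comment> \<open>Replacing a time by its residue moves its point by at most
      \<open>(1/3) ^ K\<close>, so a pair of classes is ambiguous only if the distance of its
      representatives is within two such steps of \<epsilon>.\<close>
    then have "\<bar>\<bar>orbit a - orbit b\<bar> - \<epsilon>\<bar> \<le> 2 * ?h"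
      using P unfolding close_pair_def by linarith
    then show "a \<in> {..<2 ^ K} \<and> b \<in> B a"
      using ab by (simp add: B_def)
  qed
  moreover have fin: "finite (SIGMA a:{..<2 ^ K::nat}. B a)"
    unfolding B_def by (intro finite_SigmaI) simp_all
  moreover have card_B: "card (B a) \<le> 26" for a
  proof -
    have inj: "inj_on orbit {..<2 ^ K}"
    proof (rule inj_onI, rule ccontr)
      fix b b' :: nat assume "b \<in> {..<2 ^ K}" "b' \<in> {..<2 ^ K}" "orbit b = orbit b'" "b \<noteq> b'"
      then have "(1/3) ^ Suc K \<le> (0::real)"
        using orbit_apart[of b K b'] by simp
      moreover have "(0::real) < (1/3) ^ Suc K" by simp
      ultimately show False by linarith
    qed
    have part: "card {x \<in> orbit ` {..<2 ^ K}. x \<in> {p..p + 4 * ?h}} \<le> 13" for p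
    proof -
      have "card {x \<in> orbit ` {..<2 ^ K}. x \<in> {p..p + 4 * ?h}}
          \<le> nat \<lfloor>((p + 4 * ?h) - p) / (1/3) ^ Suc K\<rfloor> + 1"
      proof (rule card_separated_le)
        show "(1/3) ^ Suc K \<le> \<bar>x - y\<bar>"
          if xy: "x \<in> {x \<in> orbit ` {..<2 ^ K}. x \<in> {p..p + 4 * ?h}}"
            "y \<in> {x \<in> orbit ` {..<2 ^ K}. x \<in> {p..p + 4 * ?h}}" "x \<noteq> y" for x y
        proof -
          obtain b b' where "x = orbit b" "y = orbit b'" "b < 2 ^ K" "b' < 2 ^ K"
            using xy(1,2) by blast
          moreover from this xy(3) have "b mod 2 ^ K \<noteq> b' mod 2 ^ K"
            by auto
          ultimately show ?thesis using orbit_apart by simp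
        qed
      qed auto
      also have "\<dots> = 13" by simp
      finally show ?thesis .
    qed
    have "orbit ` B a \<subseteq> {x \<in> orbit ` {..<2 ^ K}. x \<in> {orbit a - \<epsilon> - 2 * ?h..orbit a - \<epsilon> - 2 * ?h + 4 * ?h}}
        \<union> {x \<in> orbit ` {..<2 ^ K}. x \<in> {orbit a + \<epsilon> - 2 * ?h..orbit a + \<epsilon> - 2 * ?h + 4 * ?h}}"
    proof clarify
      fix b assume "b \<in> B a" and
        not: "\<not> (orbit b \<in> orbit ` {..<2 ^ K} \<and> orbit b \<in> {orbit a + \<epsilon> - 2 * ?h..orbit a + \<epsilon> - 2 * ?h + 4 * ?h})"
      then have b: "orbit b \<in> orbit ` {..<2 ^ K}" "\<bar>\<bar>orbit a - orbit b\<bar> - \<epsilon>\<bar> \<le> 2 * ?h"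
        unfolding B_def by blast+
      then show "orbit b \<in> orbit ` {..<2 ^ K} \<and> orbit b \<in> {orbit a - \<epsilon> - 2 * ?h..orbit a - \<epsilon> - 2 * ?h + 4 * ?h}"
        using not unfolding atLeastAtMost_iff by linarith
    qed
    then have "card (orbit ` B a) \<le> 13 + 13"
      by (rule order_trans[OF card_mono order_trans[OF card_Un_le add_mono[OF part part]], rotated]) auto
    moreover have "card (orbit ` B a) = card (B a)"
      by (rule card_image) (rule inj_on_subset[OF inj], auto simp: B_def)
    ultimately show ?thesis by simp
  qed
  moreover have "card (SIGMA a:{..<2 ^ K::nat}. B a) = (\<Sum>a<2 ^ K::nat. card (B a))"
    by (rule card_SigmaI) (simp_all add: B_def)
  ultimately have "card (ambiguous (close_pair \<epsilon>) (2 ^ K)) \<le> (\<Sum>a<2 ^ K::nat. card (B a))"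
    by (metis card_mono)
  also have "\<dots> \<le> (\<Sum>a<2 ^ K::nat. 26)"
    by (intro sum_mono card_B)
  finally show ?thesis by simp
qed

text \<open>Each of the \<open>m\<close> coordinates leaves at most \<open>26 * 2 ^ K\<close> of the
  \<open>4 ^ K\<close> pairs of classes ambiguous, a vanishing proportion.\<close>

lemma close_pair_density_convergent:
  "convergent (pair_density (\<lambda>i j. \<forall>s<m. close_pair \<epsilon> (i + s) (j + s)))"
proof (rule pair_density_convergent[where L = "\<lambda>K. 2 ^ K"])
  let ?A = "\<lambda>K. ambiguous (\<lambda>i j. \<forall>s<m. close_pair \<epsilon> (i + s) (j + s)) (2 ^ K)"
  have bound: "card (?A K) \<le> m * (26 * 2 ^ K)" for K
  proof -
    have "card (?A K) \<le> card (\<Union>s<m. ambiguous (\<lambda>i j. close_pair \<epsilon> (i + s) (j + s)) (2 ^ K))"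
      by (intro card_mono ambiguous_Ball) (simp add: finite_ambiguous)
    also have "\<dots> \<le> (\<Sum>s<m. card (ambiguous (\<lambda>i j. close_pair \<epsilon> (i + s) (j + s)) (2 ^ K)))"
      by (rule card_UN_le) simp
    also have "\<dots> \<le> (\<Sum>s<m. 26 * 2 ^ K)"
      by (intro sum_mono order_trans[OF card_ambiguous_shift card_ambiguous_close_pair]) simp
    finally show ?thesis by simp
  qed
  show "(\<lambda>K. real (card (?A K)) / (real (2 ^ K))\<^sup>2) \<longlonglongrightarrow> 0"
  proof (rule tendsto_sandwich[OF _ _ tendsto_const])
    show "\<forall>\<^sub>F K in sequentially. real (card (?A K)) / (real (2 ^ K))\<^sup>2 \<le> real m * 26 * (1/2) ^ K"
    proof (intro always_eventually allI)
      fix K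
      have "real (card (?A K)) \<le> real (m * (26 * 2 ^ K))"
        using bound by (rule of_nat_mono)
      then have "real (card (?A K)) / (real (2 ^ K))\<^sup>2 \<le> real (m * (26 * 2 ^ K)) / (real (2 ^ K))\<^sup>2"
        by (rule divide_right_mono) simp
      also have "\<dots> = real m * 26 * (1/2) ^ K"
        by (simp add: power2_eq_square power_divide)
      finally show "real (card (?A K)) / (real (2 ^ K))\<^sup>2 \<le> real m * 26 * (1/2) ^ K" .
    qed
    have "(\<lambda>K. real m * 26 * (1/2) ^ K) \<longlonglongrightarrow> real m * 26 * 0"
      by (intro tendsto_mult tendsto_const LIMSEQ_realpow_zero) auto
    then show "(\<lambda>K. real m * 26 * (1/2) ^ K) \<longlonglongrightarrow> 0" by simp
  qed simp
qed simp

text \<open>The diagonal modulo \<open>L\<close> implies \<open>P\<close> and has positive density.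
  This keeps the denominator of \<open>rdet\<close> away from 0 in the limit.\<close>

lemma pair_density_limit_pos:
  assumes "pair_density P \<longlonglongrightarrow> l" "L > 0" "\<And>i j. i mod L = j mod L \<Longrightarrow> P i j"
  shows "l > 0"
proof -
  let ?D = "\<lambda>i j. i mod L = j mod L"
  have "pair_density ?D \<longlonglongrightarrow> real (card {(a, b). a < L \<and> b < L \<and> ?D a b}) / (real L)\<^sup>2"
    using \<open>L > 0\<close> by (intro pair_density_tendsto_periodic) auto
  moreover have "pair_density ?D n \<le> pair_density P n" for n
    unfolding pair_density_def using assms(3)
    by (intro divide_right_mono of_nat_mono card_mono) (auto intro: finite_subset[of _ "{..<n} \<times> {..<n}"])
  ultimately have "real (card {(a, b). a < L \<and> b < L \<and> ?D a b}) / (real L)\<^sup>2 \<le> l"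
    using assms(1) by (intro LIMSEQ_le) auto
  moreover have "card {(a, b). a < L \<and> b < L \<and> ?D a b} > 0"
    using \<open>L > 0\<close> by (subst card_gt_0_iff) (auto intro: finite_subset[of _ "{..<L} \<times> {..<L}"])
  ultimately show ?thesis
    using \<open>L > 0\<close> by (smt (verit) divide_pos_pos of_nat_0_less_iff zero_less_power)
qed

lemma corr_sum_1_limit:
  assumes "\<epsilon> > 0"
  obtains l where "(\<lambda>n. corr_sum solenoid_map 1 0 n \<epsilon>) \<longlonglongrightarrow> l" "l > 0"
proof -
  have "\<exists>K. (1/3) ^ K < \<epsilon>"
    using assms by (intro real_arch_pow_inv) simp_all
  then obtain K where K: "(1/3) ^ K < \<epsilon>" by (rule exE)
  let ?P = "\<lambda>i j. \<forall>s<1. close_pair \<epsilon> (i + s) (j + s)"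
  obtain l where l: "pair_density ?P \<longlonglongrightarrow> l"
    using close_pair_density_convergent unfolding convergent_def by blast
  moreover have "l > 0"
    using l
  proof (rule pair_density_limit_pos[where L = "2 ^ K"])
    show "?P i j" if "i mod 2 ^ K = j mod 2 ^ K" for i j
      using orbit_close[OF that] K by (simp add: close_pair_def)
  qed simp
  ultimately show ?thesis
    using that by (simp add: corr_sum_eq_density)
qed

lemma rdet_convergent:
  assumes "\<epsilon> > 0" "m > 0"
  shows "convergent (\<lambda>n. rdet solenoid_map m 0 n \<epsilon>)"
proof -
  obtain l where l: "(\<lambda>n. corr_sum solenoid_map 1 0 n \<epsilon>) \<longlonglongrightarrow> l" "l > 0"
    using corr_sum_1_limit[OF assms(1)] by blast
  obtain c where c: "(\<lambda>n. corr_sum solenoid_map m 0 n \<epsilon>) \<longlonglongrightarrow> c"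
    using close_pair_density_convergent[of m \<epsilon>]
    unfolding convergent_def corr_sum_eq_density[OF assms(2)] by blast
  show ?thesis
    unfolding rdet_def convergent_def using tendsto_divide[OF c l(1)] l(2) by auto
qed

section \<open>Recurrence at the critical scales\<close>

lemma close_pair_critical:
  "close_pair ((1/3) ^ (r + 2)) i j \<longleftrightarrow>
     i mod 2 ^ (r + 2) = j mod 2 ^ (r + 2) \<or> odd i \<and> i mod 2 ^ (r + 1) = j mod 2 ^ (r + 1)"
proof (cases "even i \<longleftrightarrow> even j")
  case True
  \<comment> \<open>Even times show \<open>vdc\<close> at scale 1/3 and odd times at scale 1/9, so
    the thresholds for \<open>vdc\<close> differ by a factor 3.\<close>
  have "close_pair ((1/3) ^ (r + 2)) i j \<longleftrightarrow>
      \<bar>vdc (i div 2) - vdc (j div 2)\<bar> \<le> (if even i then (1/3) ^ Suc r else (1/3) ^ r)"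
    using True orbit_dist[of i j] by (cases "even i") (auto simp: close_pair_def)
  also have "\<dots> \<longleftrightarrow> (if even i then i div 2 mod 2 ^ Suc r = j div 2 mod 2 ^ Suc r
      else i div 2 mod 2 ^ r = j div 2 mod 2 ^ r)"
    by (auto simp only: vdc_dist_le_iff split: if_splits)
  finally have *: "close_pair ((1/3) ^ (r + 2)) i j \<longleftrightarrow>
      (if even i then i div 2 mod 2 ^ Suc r = j div 2 mod 2 ^ Suc r
      else i div 2 mod 2 ^ r = j div 2 mod 2 ^ r)" .
  \<comment> \<open>Agreement modulo the higher power implies agreement modulo the lower one, which
    turns the case distinction by parity into a disjunction.\<close>
  have imp: "i div 2 mod 2 ^ r = j div 2 mod 2 ^ r"
    if "i div 2 mod 2 ^ Suc r = j div 2 mod 2 ^ Suc r"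
  proof -
    have dvd: "(2::nat) ^ r dvd 2 ^ Suc r" by simp
    from that have "i div 2 mod 2 ^ Suc r mod 2 ^ r = j div 2 mod 2 ^ Suc r mod 2 ^ r"
      by (rule arg_cong)
    then show ?thesis
      unfolding mod_mod_cancel[OF dvd] .
  qed
  have "i mod 2 ^ (r + 2) = j mod 2 ^ (r + 2) \<longleftrightarrow> i div 2 mod 2 ^ Suc r = j div 2 mod 2 ^ Suc r"
    unfolding add_2_eq_Suc' mod_2_power_Suc[of i "Suc r" j] using True by blast
  moreover have "i mod 2 ^ (r + 1) = j mod 2 ^ (r + 1) \<longleftrightarrow> i div 2 mod 2 ^ r = j div 2 mod 2 ^ r"
    unfolding Suc_eq_plus1[symmetric] mod_2_power_Suc[of i r j] using True by blast
  moreover have "(if P then A else B) \<longleftrightarrow> A \<or> \<not> P \<and> B" if "A \<Longrightarrow> B" for P A B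
    using that by auto
  ultimately show ?thesis
    unfolding * using imp by presburger
next
  case False
  \<comment> \<open>The offset 2 in the exponent gives \<epsilon> \<le> 1/9, whereas points at times
    of different parity are more than 1/2 apart.\<close>
  have "(1/3 :: real) ^ (r + 2) \<le> 1/3 * (1/3)"
    using power_le_one[of "1/3::real" r] by simp
  then have "\<not> close_pair ((1/3) ^ (r + 2)) i j"
    using orbit_dist_mixed[OF False] by (simp add: close_pair_def)
  moreover have "r + 2 = Suc (Suc r)" "r + 1 = Suc r" by simp_all
  ultimately show ?thesis
    using False by (simp only: mod_2_power_Suc) blast
qed

text \<open>One of the times \<open>i\<close> and \<open>i + 1\<close> is even, and there closeness
  demands agreement modulo the full \<open>2 ^ (r + 2)\<close>. Longer windows demand no more, since
  shifts preserve this congruence.\<close>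

lemma close_orbit_critical:
  assumes "m \<ge> 2"
  shows "(\<forall>s<m. close_pair ((1/3) ^ (r + 2)) (i + s) (j + s)) \<longleftrightarrow>
    i mod 2 ^ (r + 2) = j mod 2 ^ (r + 2)"
proof
  assume close: "\<forall>s<m. close_pair ((1/3) ^ (r + 2)) (i + s) (j + s)"
  have "close_pair ((1/3) ^ (r + 2)) (i + 0) (j + 0)" "close_pair ((1/3) ^ (r + 2)) (i + 1) (j + 1)"
    using close[rule_format, of 0] close[rule_format, of 1] assms by simp_all
  then have "i mod 2 ^ (r + 2) = j mod 2 ^ (r + 2) \<or> odd i"
    "(i + 1) mod 2 ^ (r + 2) = (j + 1) mod 2 ^ (r + 2) \<or> odd (i + 1)"
    unfolding close_pair_critical add_0_right by blast+
  then consider "i mod 2 ^ (r + 2) = j mod 2 ^ (r + 2)"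
    | "(i + 1) mod 2 ^ (r + 2) = (j + 1) mod 2 ^ (r + 2)"
    unfolding even_add by (cases "odd i") simp_all
  then show "i mod 2 ^ (r + 2) = j mod 2 ^ (r + 2)"
  proof cases
    case 2
    \<comment> \<open>Adding the modulus minus 1 undoes the shift by 1.\<close>
    have eq: "n + 1 + (2 ^ (r + 2) - 1) = n + 2 ^ (r + 2)" for n :: nat
      using one_le_power[of "2::nat" "r + 2"] by linarith
    have "(i + 1 + (2 ^ (r + 2) - 1)) mod 2 ^ (r + 2) = (j + 1 + (2 ^ (r + 2) - 1)) mod 2 ^ (r + 2)"
      using 2 refl by (rule mod_add_cong)
    then show ?thesis unfolding eq mod_add_self2 .
  qed
next
  assume "i mod 2 ^ (r + 2) = j mod 2 ^ (r + 2)"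
  then show "\<forall>s<m. close_pair ((1/3) ^ (r + 2)) (i + s) (j + s)"
    unfolding close_pair_critical by (intro allI impI disjI1 mod_add_cong refl)
qed

lemma card_diagonal: "card {(a, b). a < L \<and> b < L \<and> a mod L = b mod L} = L" for L :: nat
proof -
  have "{(a, b). a < L \<and> b < L \<and> a mod L = b mod L} = (\<lambda>a. (a, a)) ` {..<L}"
    by auto
  then show ?thesis by (simp add: card_image inj_on_def)
qed

text \<open>The diagonal contributes \<open>2 * h\<close> pairs, and each of the \<open>h\<close>
  odd classes has a further partner, its translate by \<open>h\<close> modulo \<open>L\<close>. A
  lower bound suffices because the count enters a denominator.\<close>

lemma card_critical_pairs:
  assumes "L = 2 * h" "even h" "h > 0"
  shows "3 * h \<le> card {(a, b). a < L \<and> b < L \<and> (a mod L = b mod L \<or> odd a \<and> a mod h = b mod h)}"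
proof -
  let ?D = "(\<lambda>a. (a, a)) ` {..<L}"
  let ?W = "(\<lambda>i. (2 * i + 1, (2 * i + 1 + h) mod L)) ` {..<h}"
  have "card ?D = L" by (simp add: card_image inj_on_def)
  moreover have "card ?W = h" by (simp add: card_image inj_on_def)
  moreover have "?D \<inter> ?W = {}"
  proof -
    have *: "(a + h) mod L \<noteq> a" if "a < L" for a
    proof (cases "a < h")
      case True
      then show ?thesis using assms by simp
    next
      case False
      then have "(a + h) mod L = (a - h) mod L"
        using assms mod_add_self2[of "a - h" L] by (simp add: algebra_simps)
      then show ?thesis using False assms that by simp
    qed
    show ?thesis
    proof (rule equals0I)
      fix x assume "x \<in> ?D \<inter> ?W"
      then obtain i where "i < h" "(2 * i + 1 + h) mod L = 2 * i + 1" by auto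
      then show False using *[of "2 * i + 1"] assms(1) by simp
    qed
  qed
  ultimately have "card (?D \<union> ?W) = 3 * h"
    using assms(1) by (subst card_Un_disjoint) auto
  moreover have "card (?D \<union> ?W) \<le> card {(a, b). a < L \<and> b < L \<and> (a mod L = b mod L \<or> odd a \<and> a mod h = b mod h)}"
  proof (rule card_mono)
    have "(2 * i + 1 + h) mod L mod h = (2 * i + 1) mod h" for i
      by (simp only: assms(1) mod_mod_cancel[OF dvd_triv_right] mod_add_self2)
    then show "?D \<union> ?W \<subseteq> {(a, b). a < L \<and> b < L \<and> (a mod L = b mod L \<or> odd a \<and> a mod h = b mod h)}"
      using assms by auto
  qed (rule finite_subset[of _ "{..<L} \<times> {..<L}"], auto)
  ultimately show ?thesis by simp
qed

text \<open>For \<open>m \<ge> 2\<close> the numerator always counts the diagonal modulo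
  \<open>L\<close>, so one \<open>q\<close> serves all \<open>m\<close>; its bound is
  \<open>2 * h / (3 * h)\<close>.\<close>

lemma rdet_critical_limit:
  obtains q where "q \<le> 2/3"
    "\<And>m. m \<ge> 2 \<Longrightarrow> (\<lambda>n. rdet solenoid_map m 0 n ((1/3) ^ (r + 2))) \<longlonglongrightarrow> q"
proof -
  let ?\<epsilon> = "(1/3) ^ (r + 2) :: real"
  define h :: nat where "h = 2 ^ (r + 1)"
  define L :: nat where "L = 2 ^ (r + 2)"
  have L: "L = 2 * h" and h: "even h" "h > 0"
    by (simp_all add: h_def L_def)
  define T where "T = card {(a, b). a < L \<and> b < L \<and> (a mod L = b mod L \<or> odd a \<and> a mod h = b mod h)}"
  have T: "3 * h \<le> T"
    unfolding T_def by (rule card_critical_pairs[OF L h])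
  have "(\<lambda>n. corr_sum solenoid_map 1 0 n ?\<epsilon>) \<longlonglongrightarrow> real T / (real L)\<^sup>2"
  proof -
    have "(\<forall>s<1. close_pair ?\<epsilon> (i + s) (j + s)) \<longleftrightarrow>
        i mod L = j mod L \<or> odd i \<and> i mod h = j mod h" for i j
      unfolding h_def L_def close_pair_critical[symmetric] by (simp only: less_one) simp
    then have "(\<lambda>i j. \<forall>s<1. close_pair ?\<epsilon> (i + s) (j + s)) =
        (\<lambda>i j. i mod L = j mod L \<or> odd i \<and> i mod h = j mod h)"
      by (intro ext)
    moreover have "pair_density (\<lambda>i j. i mod L = j mod L \<or> odd i \<and> i mod h = j mod h)
        \<longlonglongrightarrow> real T / (real L)\<^sup>2"
      unfolding T_def
    proof (rule pair_density_tendsto_periodic)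
      have "odd (i mod L) \<longleftrightarrow> odd i" "i mod L mod h = i mod h" for i
        using L by (simp_all add: dvd_mod_iff mod_mod_cancel)
      then show "(i mod L = j mod L \<or> odd i \<and> i mod h = j mod h) \<longleftrightarrow>
          (i mod L mod L = j mod L mod L \<or> odd (i mod L) \<and> i mod L mod h = j mod L mod h)" for i j
        by simp
    qed (use L h in simp)
    ultimately show ?thesis
      by (simp only: corr_sum_eq_density[OF zero_less_one])
  qed
  moreover have "(\<lambda>n. corr_sum solenoid_map m 0 n ?\<epsilon>) \<longlonglongrightarrow> real L / (real L)\<^sup>2" if "m \<ge> 2" for m
  proof -
    have "pair_density (\<lambda>i j. i mod L = j mod L) \<longlonglongrightarrow> real L / (real L)\<^sup>2"
      using pair_density_tendsto_periodic[of L "\<lambda>i j. i mod L = j mod L"] L h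
      by (simp add: card_diagonal)
    moreover have "(\<lambda>i j. \<forall>s<m. close_pair ?\<epsilon> (i + s) (j + s)) = (\<lambda>i j. i mod L = j mod L)"
      unfolding close_orbit_critical[OF that] L_def by (rule refl)
    moreover have "m > 0" using that by simp
    ultimately show ?thesis
      by (simp only: corr_sum_eq_density)
  qed
  moreover have "real T / (real L)\<^sup>2 \<noteq> 0"
    using T L h by simp
  ultimately have "(\<lambda>n. rdet solenoid_map m 0 n ?\<epsilon>) \<longlonglongrightarrow> (real L / (real L)\<^sup>2) / (real T / (real L)\<^sup>2)"
    if "m \<ge> 2" for m
    unfolding rdet_def using that by (intro tendsto_divide)
  moreover have "(real L / (real L)\<^sup>2) / (real T / (real L)\<^sup>2) \<le> 2/3"
  proof -
    have "3 * real h \<le> real T" using T by linarith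
    then show ?thesis using L h by (simp add: field_simps)
  qed
  ultimately show ?thesis using that by blast
qed

text \<open>The scales \<open>(1/3) ^ (r + 2)\<close> tend to 0, while a lower limit of at least 1
  would force values above 2/3 at all small \<epsilon>.\<close>

lemma Liminf_at_right_0_less_1:
  fixes X :: "real \<Rightarrow> real"
  assumes "\<And>r. X ((1/3) ^ (r + 2)) \<le> 2/3"
  shows "Liminf (at_right 0) (\<lambda>\<epsilon>. ereal (X \<epsilon>)) < 1"
proof (rule ccontr)
  assume "\<not> ?thesis"
  then have "1 \<le> Liminf (at_right 0) (\<lambda>\<epsilon>. ereal (X \<epsilon>))" by simp
  then have "\<forall>\<^sub>F \<epsilon> in at_right 0. ereal (2/3) < ereal (X \<epsilon>)"
    unfolding le_Liminf_iff by (rule allE[of _ "ereal (2/3)"]) simp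
  then have "\<forall>\<^sub>F \<epsilon> in at_right 0. 2/3 < X \<epsilon>"
    by (simp only: ereal_less_eq less_ereal.simps)
  then obtain b where b: "b > 0" "\<forall>\<epsilon>>0. \<epsilon> < b \<longrightarrow> 2/3 < X \<epsilon>"
    unfolding eventually_at_right_field by blast
  have "\<exists>k. (1/3) ^ k < b"
    using b(1) by (intro real_arch_pow_inv) simp_all
  then obtain k where k: "(1/3) ^ k < b" by (rule exE)
  have "(1/3) ^ (k + 2) \<le> (1/3 :: real) ^ k"
    by (rule power_decreasing) simp_all
  with k have "(1/3) ^ (k + 2) < b" by linarith
  moreover have "(0::real) < (1/3) ^ (k + 2)" by simp
  ultimately have "2/3 < X ((1/3) ^ (k + 2))"
    using b(2) by blast
  then show False using assms[of k] by simp
qed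

theorem proposition13:
  shows "\<exists>(f :: real \<Rightarrow> real) (x :: real).
    continuous_on {0..1} f \<and> f ` {0..1} \<subseteq> {0..1} \<and>
    topological_entropy {0..1} f = 0 \<and>
    \<not> Li_Yorke_chaotic {0..1} f \<and>
    x \<in> {0..1} \<and>
    solenoidal {0..1} f (omega_limit_set f x) \<and>
    (\<forall>m\<ge>2.
      (\<forall>\<epsilon>>0. convergent (\<lambda>n. rdet f m x n \<epsilon>) \<and> convergent (\<lambda>n. DET f m x n \<epsilon>)) \<and>
      Liminf (at_right 0) (\<lambda>\<epsilon>. ereal (asymp_rdet f m x \<epsilon>)) < 1 \<and>
      Liminf (at_right 0) (\<lambda>\<epsilon>. ereal (asymp_DET f m x \<epsilon>)) < 1)"
proof (intro exI[of _ solenoid_map] exI[of _ "0::real"] conjI allI impI)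
  fix m :: nat assume m: "m \<ge> 2"
  show "convergent (\<lambda>n. rdet solenoid_map m 0 n \<epsilon>)" if "\<epsilon> > 0" for \<epsilon>
    using that m by (intro rdet_convergent) simp_all
  show "convergent (\<lambda>n. DET solenoid_map m 0 n \<epsilon>)" if \<epsilon>: "\<epsilon> > 0" for \<epsilon>
  proof -
    obtain p q where "(\<lambda>n. rdet solenoid_map m 0 n \<epsilon>) \<longlonglongrightarrow> p"
      "(\<lambda>n. rdet solenoid_map (m + 1) 0 n \<epsilon>) \<longlonglongrightarrow> q"
      using rdet_convergent[OF \<epsilon>, of m] rdet_convergent[OF \<epsilon>, of "m + 1"] m
      unfolding convergent_def by auto
    then have "(\<lambda>n. DET solenoid_map m 0 n \<epsilon>) \<longlonglongrightarrow> real m * p - (real m - 1) * q"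
      unfolding DET_def by (intro tendsto_intros)
    then show ?thesis unfolding convergent_def by blast
  qed
  show "Liminf (at_right 0) (\<lambda>\<epsilon>. ereal (asymp_rdet solenoid_map m 0 \<epsilon>)) < 1"
  proof (rule Liminf_at_right_0_less_1)
    fix r
    obtain q where "q \<le> 2/3" "\<And>m. m \<ge> 2 \<Longrightarrow> (\<lambda>n. rdet solenoid_map m 0 n ((1/3) ^ (r + 2))) \<longlonglongrightarrow> q"
      using rdet_critical_limit[of r] by blast
    then show "asymp_rdet solenoid_map m 0 ((1/3) ^ (r + 2)) \<le> 2/3"
      unfolding asymp_rdet_def using limI[of _ q] m by simp
  qed
  show "Liminf (at_right 0) (\<lambda>\<epsilon>. ereal (asymp_DET solenoid_map m 0 \<epsilon>)) < 1"
  proof (rule Liminf_at_right_0_less_1)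
    fix r
    obtain q where q: "q \<le> 2/3" "\<And>m. m \<ge> 2 \<Longrightarrow> (\<lambda>n. rdet solenoid_map m 0 n ((1/3) ^ (r + 2))) \<longlonglongrightarrow> q"
      using rdet_critical_limit[of r] by blast
    \<comment> \<open>Orders \<open>m\<close> and \<open>m + 1\<close> share the limit
      \<open>q\<close>, so the combination collapses to \<open>q\<close>.\<close>
    have "(\<lambda>n. DET solenoid_map m 0 n ((1/3) ^ (r + 2))) \<longlonglongrightarrow> real m * q - (real m - 1) * q"
      unfolding DET_def using m by (intro tendsto_intros q(2)) simp_all
    then show "asymp_DET solenoid_map m 0 ((1/3) ^ (r + 2)) \<le> 2/3"
      unfolding asymp_DET_def using q(1) by (subst limI) (auto simp: algebra_simps)
  qed
next
  show "solenoid_map ` {0..1} \<subseteq> {0..1}"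
    using solenoid_map_in_unit by blast
qed (simp_all add: solenoid_map_continuous solenoid_entropy solenoid_not_chaotic solenoid_solenoidal)

end
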